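(* For all integers $n>k\ge 1$, the quasisymmetric functions $$\mathcal{Q}(G_{n,k}):=\sum_{p\in G_{n,k}}\mathcal{F}_{\operatorname{Des}(p)}\qquad\text{and}\qquad \mathcal{Q}(T_{n,k}):=\sum_{p\in T_{n,k}}\mathcal{F}_{\operatorname{Des}(p)}$$ are symmetric and Schur-positive.
   Context: $K_n$ is the complete graph on vertex set $\{1,\dots,n\}$; $\overrightarrow{K}_n$ is the transitive tournament with vertex set $\{1,\dots,n\}$ and directed edges $(i,j)$, $i<j$. $G_{n,k}$ is the set of Gallai $k$-partitions of $K_n$: unordered partitions of the edge set into $k$ nonempty blocks such that every cycle contains at least two edges in the same block. $T_{n,k}$ is the set of transitive $k$-partitions of $\overrightarrow{K}_n$: unordered partitions of the edge set into $k$ nonempty blocks such that every cycle of the underlying undirected graph contains two edges in the same block that have opposite orientations with respect to a traversal of the cycle. The descent set of such a partition $p$ is $\operatorname{Des}(p):=\{i\in\{1,\dots,n-1\}: \text{the edge }(i,i+1)\text{ forms a singleton block in }p\}$. For $J\subseteq\{1,\dots,n-1\}$, the fundamental quasisymmetric function is $\mathcal{F}_J(\mathbf{x}):=\sum x_{i_1}x_{i_2}\cdots x_{i_n}$, summed over $i_1\le i_2\le\dots\le i_n$ with $i_j<i_{j+1}$ whenever $j\in J$. A symmetric function is Schur-positive if all coefficients in its expansion in the Schur basis are nonnegative. *)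

theory Defs
  imports Main "HOL-Library.Multiset" "HOL-Library.Disjoint_Sets"
begin

section \<open>Formal power series in countably many variables\<close>

text \<open>
  A monomial is the multiset of (indices of) its variables, and a formal power series with
  integer coefficients maps each monomial to its coefficient. Variables are indexed from 0.
\<close>

type_synonym monomial = "nat multiset"
type_synonym series = "monomial \<Rightarrow> int"

text \<open>
  The sum over \<open>a \<in> A\<close> of the monomials \<open>w a\<close>. It is only meaningful if each monomial is the
  weight of finitely many elements of \<open>A\<close>, which holds for both uses below.
\<close>

definition weight_series :: "'a set \<Rightarrow> ('a \<Rightarrow> monomial) \<Rightarrow> series" where
  "weight_series A w = (\<lambda>m. int (card {a \<in> A. w a = m}))"

definition symmetric_function :: "series \<Rightarrow> bool" where
  "symmetric_function f \<longleftrightarrow>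
     (\<exists>d. \<forall>m. f m \<noteq> 0 \<longrightarrow> size m \<le> d) \<and>
     (\<forall>\<pi>. bij \<pi> \<longrightarrow> (\<forall>m. f (image_mset \<pi> m) = f m))"

text \<open>
  List positions start at 0, so the entry written $i_j$ in the usual definition is
  \<open>is ! (j - 1)\<close>. Intended for \<open>J \<subseteq> {1..<n}\<close>.
\<close>

definition fundamental :: "nat \<Rightarrow> nat set \<Rightarrow> series" where
  "fundamental n J =
     weight_series {is. length is = n \<and> sorted is \<and> (\<forall>j\<in>J. is ! (j - 1) < is ! j)} mset"


section \<open>Schur functions\<close>

definition int_partition :: "nat list \<Rightarrow> bool" where
  "int_partition lam \<longleftrightarrow> sorted_wrt (\<ge>) lam \<and> 0 \<notin> set lam"

text \<open>Tableaux are lists of rows, in English notation.\<close>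

definition SSYT :: "nat list \<Rightarrow> nat list list set" where
  "SSYT lam = {T. map length T = lam \<and> (\<forall>row\<in>set T. sorted row) \<and>
     (\<forall>i j. Suc i < length T \<and> j < length (T ! Suc i) \<longrightarrow> T ! i ! j < T ! Suc i ! j)}"

definition schur :: "nat list \<Rightarrow> series" where
  "schur lam = weight_series (SSYT lam) (\<lambda>T. mset (concat T))"

definition schur_expansion :: "series \<Rightarrow> (nat list \<Rightarrow> int) \<Rightarrow> bool" where
  "schur_expansion f c \<longleftrightarrow>
     finite {lam. c lam \<noteq> 0} \<and> {lam. c lam \<noteq> 0} \<subseteq> Collect int_partition \<and>
     f = (\<lambda>m. \<Sum>lam | c lam \<noteq> 0. c lam * schur lam m)"

text \<open>
  The Schur functions indexed by integer partitions are linearly independent, so the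
  expansion below is the unique one.
\<close>

definition schur_positive :: "series \<Rightarrow> bool" where
  "schur_positive f \<longleftrightarrow>
     symmetric_function f \<and> (\<exists>c. schur_expansion f c \<and> (\<forall>lam. c lam \<ge> 0))"


section \<open>Gallai and transitive partitions\<close>

text \<open>
  A cycle is given by the list of its vertices in the order of a traversal; its steps are
  the pairs of consecutive vertices, including the one from the last vertex to the first.
\<close>

definition steps :: "nat list \<Rightarrow> (nat \<times> nat) set" where
  "steps vs = {(vs ! i, vs ! (Suc i mod length vs)) | i. i < length vs}"

definition is_cycle :: "nat set set \<Rightarrow> nat list \<Rightarrow> bool" where
  "is_cycle E vs \<longleftrightarrow> length vs \<ge> 3 \<and> distinct vs \<and> (\<forall>(u, v)\<in>steps vs. {u, v} \<in> E)"

definition complete_edges :: "nat \<Rightarrow> nat set set" where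
  "complete_edges n = {{i, j} | i j. i \<in> {1..n} \<and> j \<in> {1..n} \<and> i \<noteq> j}"

definition tournament_edges :: "nat \<Rightarrow> (nat \<times> nat) set" where
  "tournament_edges n = {(i, j). i \<in> {1..n} \<and> j \<in> {1..n} \<and> i < j}"

definition underlying_edges :: "(nat \<times> nat) set \<Rightarrow> nat set set" where
  "underlying_edges E = {{i, j} | i j. (i, j) \<in> E}"

definition gallai_partitions :: "nat \<Rightarrow> nat \<Rightarrow> nat set set set set" where
  "gallai_partitions n k = {p. partition_on (complete_edges n) p \<and> card p = k \<and>
     (\<forall>vs. is_cycle (complete_edges n) vs \<longrightarrow>
       (\<exists>B\<in>p. \<exists>(u, v)\<in>steps vs. \<exists>(u', v')\<in>steps vs.
          {u, v} \<noteq> {u', v'} \<and> {u, v} \<in> B \<and> {u', v'} \<in> B))}"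

text \<open>
  In the condition below the traversal passes the edge \<open>(u, v)\<close> forwards and the edge
  \<open>(v', u')\<close> backwards.
\<close>

definition transitive_partitions :: "nat \<Rightarrow> nat \<Rightarrow> (nat \<times> nat) set set set" where
  "transitive_partitions n k = {p. partition_on (tournament_edges n) p \<and> card p = k \<and>
     (\<forall>vs. is_cycle (underlying_edges (tournament_edges n)) vs \<longrightarrow>
       (\<exists>B\<in>p. \<exists>(u, v)\<in>steps vs. \<exists>(u', v')\<in>steps vs. (u, v) \<in> B \<and> (v', u') \<in> B))}"

text \<open>
  The parameter \<open>edge\<close> is the encoding of edges: unordered pairs for the complete graph,
  ordered pairs for the tournament.
\<close>

definition descents :: "nat \<Rightarrow> (nat \<Rightarrow> nat \<Rightarrow> 'e) \<Rightarrow> 'e set set \<Rightarrow> nat set" where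
  "descents n edge p = {i \<in> {1..n - 1}. {edge i (i + 1)} \<in> p}"

definition Q_gallai :: "nat \<Rightarrow> nat \<Rightarrow> series" where
  "Q_gallai n k = (\<lambda>m. \<Sum>p\<in>gallai_partitions n k. fundamental n (descents n (\<lambda>i j. {i, j}) p) m)"

definition Q_transitive :: "nat \<Rightarrow> nat \<Rightarrow> series" where
  "Q_transitive n k = (\<lambda>m. \<Sum>p\<in>transitive_partitions n k. fundamental n (descents n Pair p) m)"

end

theory Submission
  imports Defs "HOL-Computational_Algebra.Polynomial"
begin

text \<open>
  In both kinds of partitions it suffices to look at triangles. If \<open>(i, i + 1)\<close> is a singleton
  block, the triangle condition makes \<open>i\<close> and \<open>i + 1\<close> twins that can be contracted. Hence
  descent sets contain no two consecutive numbers, and the number of partitions whose descent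
  set includes a given set \<open>J\<close> without consecutive elements depends only on the size of \<open>J\<close>,
  say it is \<open>h |J|\<close>.

  By inclusion and exclusion, the coefficient of a monomial \<open>m\<close> in the quasisymmetric function is
  the image under the linear map \<open>t ^ r \<mapsto> h r\<close> of the product of \<open>U (count m x)\<close> over the
  variables \<open>x\<close>, where \<open>U a\<close> is the signed matching polynomial of a path with \<open>a\<close> vertices.
  This is symmetric. The product rule for the polynomials \<open>U a\<close> (Clebsch-Gordan) and the Pieri rule
  expand this product as the sum of \<open>t ^ j * U (n - 2 * j)\<close> times the coefficient of the two-row
  Schur function of shape \<open>(n - j, j)\<close>. Finally the image of \<open>t ^ j * U (n - 2 * j)\<close>
  is nonnegative since it counts the partitions with descent set
  \<open>{n - 1, n - 3, \<dots>, n - 2 * j + 1}\<close>.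
\<close>

section \<open>Matching polynomials of paths\<close>

abbreviation t :: "int poly" where "t \<equiv> monom 1 1"

text \<open>A matching with \<open>r\<close> edges has weight \<open>(- t) ^ r\<close>, and the
  recursion asks whether an end edge is used. Up to rescaling these are Chebyshev polynomials of the
  second kind: put \<open>t = 1 / (4 * x ^ 2)\<close> and multiply by
  \<open>(2 * x) ^ a\<close>.\<close>

fun path_poly :: "nat \<Rightarrow> int poly" where
  "path_poly 0 = 1"
| "path_poly (Suc 0) = 1"
| "path_poly (Suc (Suc a)) = path_poly (Suc a) - t * path_poly a"

text \<open>Cut a path with \<open>a + b + 2\<close> vertices at the edge after its first
  \<open>a + 1\<close> vertices: a matching either avoids this edge, or uses it with weight
  \<open>- t\<close> and loses both its ends.\<close>

lemma path_poly_Suc_mult: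
  "path_poly (Suc a) * path_poly (Suc b) =
     path_poly (Suc (Suc (a + b))) + t * (path_poly a * path_poly b)"
proof (induction a rule: path_poly.induct)
  case (3 a)
  have "path_poly (Suc (Suc (Suc a))) * path_poly (Suc b) =
      path_poly (Suc (Suc a)) * path_poly (Suc b) - t * (path_poly (Suc a) * path_poly (Suc b))"
    by (simp add: algebra_simps)
  also have "\<dots> = path_poly (Suc (Suc (Suc a + b))) + t * (path_poly (Suc a) * path_poly b)
      - t * (path_poly (Suc (Suc (a + b))) + t * (path_poly a * path_poly b))"
    by (simp only: 3)
  also have "\<dots> = path_poly (Suc (Suc (Suc (Suc a) + b))) +
      t * (path_poly (Suc (Suc a)) * path_poly b)"
    by (simp add: algebra_simps)
  finally show ?case .
qed (simp_all add: algebra_simps)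

text \<open>The Clebsch-Gordan rule: iterating the cut shortens both paths by one vertex at a time
  until the shorter one is used up.\<close>

lemma path_poly_mult:
  "path_poly a * path_poly b = (\<Sum>i\<le>min a b. t ^ i * path_poly (a + b - 2 * i))"
proof (induction a arbitrary: b)
  case (Suc a)
  show ?case
  proof (cases b)
    case (Suc b')
    have "path_poly (Suc a) * path_poly b = path_poly (Suc a + b) +
        t * (\<Sum>i\<le>min a b'. t ^ i * path_poly (a + b' - 2 * i))"
      by (simp only: Suc path_poly_Suc_mult Suc.IH add_Suc add_Suc_right)
    then show ?thesis
      by (simp only: Suc min_Suc_Suc sum.atMost_Suc_shift sum_distrib_left power_Suc)
        (simp add: algebra_simps)
  qed simp
qed simp

section \<open>Matchings within the runs of a word\<close>

fun list_poly :: "'a list \<Rightarrow> int poly" where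
  "list_poly [] = 1"
| "list_poly [x] = 1"
| "list_poly (x # y # l) = list_poly (y # l) - (if x = y then t * list_poly l else 0)"

text \<open>\<open>list_poly\<close> weighs matchings of neighbouring equal entries. The assumption
  ends the run of \<open>x\<close> before \<open>l\<close>, so no matchable pair crosses that point
  and the weight factors.\<close>

lemma list_poly_replicate_append:
  assumes "l = [] \<or> hd l \<noteq> x"
  shows "list_poly (replicate a x @ l) = path_poly a * list_poly l"
proof (induction a rule: path_poly.induct)
  case 2
  then show ?case using assms by (cases l) auto
qed (simp_all add: algebra_simps)

lemma list_poly_replicate: "list_poly (replicate a x) = path_poly a"
  using list_poly_replicate_append[of "[]"] by simp

text \<open>All copies of the largest element are removed at once, because the factorisation into
  runs and the Pieri rule both treat one value at a time.\<close>

lemma multiset_Max_induct [case_names empty add]: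
  fixes m :: "'a :: linorder multiset"
  assumes "P {#}"
    and add: "\<And>m x b. \<lbrakk>\<And>y. y \<in># m \<Longrightarrow> y < x; 0 < b; P m\<rbrakk> \<Longrightarrow> P (m + replicate_mset b x)"
  shows "P m"
proof (induction "size m" arbitrary: m rule: less_induct)
  case less
  show ?case
  proof (cases "m = {#}")
    case False
    define x where "x = Max (set_mset m)"
    define m' where "m' = filter_mset (\<lambda>y. y < x) m"
    have x: "x \<in># m" "\<And>y. y \<in># m \<Longrightarrow> y \<le> x"
      using False by (auto simp: x_def)
    have m: "m = m' + replicate_mset (count m x) x"
    proof (rule multiset_eqI)
      fix y
      show "count m y = count (m' + replicate_mset (count m x) x) y"
      proof (cases y x rule: linorder_cases)
        case greater
        then have "count m y = 0"
          using x(2)[of y] by (meson count_inI linorder_not_less)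
        with greater show ?thesis by (simp add: m'_def)
      qed (simp_all add: m'_def)
    qed
    have "size m = size m' + count m x" using arg_cong[OF m, of size] by simp
    moreover have "0 < count m x" using x(1) by simp
    ultimately have "size m' < size m" by linarith
    then have "P m'" by (rule less)
    have "P (m' + replicate_mset (count m x) x)"
      by (rule add) (use x(1) \<open>P m'\<close> in \<open>auto simp: m'_def\<close>)
    then show ?thesis using m by simp
  qed (simp add: assms)
qed

text \<open>Sorting gathers the copies of a value into one run, whose length is the multiplicity.
  The reversal puts the run of the largest value first, where
  \<open>list_poly_replicate_append\<close> splits it off.\<close>

lemma list_poly_rev_sorted:
  "list_poly (rev (sorted_list_of_multiset m)) = (\<Prod>x\<in>set_mset m. path_poly (count m x))"
proof (induction m rule: multiset_Max_induct)
  case (add m x b)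
  have "sorted_list_of_multiset (m + replicate_mset b x) =
      sort (sorted_list_of_multiset m @ replicate b x)"
    by (metis mset_append mset_replicate mset_sorted_list_of_multiset sorted_list_of_multiset_mset)
  also have "\<dots> = sorted_list_of_multiset m @ replicate b x"
    by (rule sorted_sort_id) (use add(1) in \<open>auto simp: sorted_append intro: less_imp_le\<close>)
  finally have "list_poly (rev (sorted_list_of_multiset (m + replicate_mset b x))) =
      list_poly (replicate b x @ rev (sorted_list_of_multiset m))"
    by simp
  also have "\<dots> = path_poly b * list_poly (rev (sorted_list_of_multiset m))"
  proof (rule list_poly_replicate_append)
    show "rev (sorted_list_of_multiset m) = [] \<or> hd (rev (sorted_list_of_multiset m)) \<noteq> x"
      using add(1) hd_in_set[of "rev (sorted_list_of_multiset m)"] by force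
  qed
  also have "\<dots> = path_poly b * (\<Prod>y\<in>set_mset m. path_poly (count m y))"
    by (simp only: add)
  also have "\<dots> = (\<Prod>y\<in>set_mset (m + replicate_mset b x). path_poly (count (m + replicate_mset b x) y))"
  proof -
    have x: "x \<notin># m" using add(1) by blast
    then have "set_mset (m + replicate_mset b x) = insert x (set_mset m)"
      using add(2) by auto
    moreover have "(\<Prod>y\<in>set_mset m. path_poly (count m y)) =
        (\<Prod>y\<in>set_mset m. path_poly (count (m + replicate_mset b x) y))"
      using x by (intro prod.cong) auto
    ultimately show ?thesis using x by (simp add: not_in_iff)
  qed
  finally show ?case .
qed simp

section \<open>Two-row Schur functions\<close>

lemma size_filter_replicate_mset:
  "size (filter_mset P (replicate_mset k x)) = (if P x then k else 0)"
  by (induction k) auto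

text \<open>The possible second rows of a tableau with at most two rows and content \<open>m\<close>.\<close>

definition second_rows :: "'a :: linorder multiset \<Rightarrow> 'a multiset set" where
  "second_rows m = {R. R \<subseteq># m \<and>
     (\<forall>x. size {#y \<in># R. y \<le> x#} \<le> size {#y \<in># m - R. y < x#})}"

lemma second_rows_empty: "second_rows {#} = {{#}}"
  by (auto simp: second_rows_def)

text \<open>The Pieri rule for two rows. Of the \<open>b\<close> copies of the new maximum
  \<open>x\<close>, \<open>i\<close> enter the second row; column strictness only demands that this
  row still fits under the old first row, that is
  \<open>size R + i \<le> size m - size R\<close>.\<close>

lemma second_rows_add:
  fixes m :: "'a :: linorder multiset"
  assumes less: "\<And>y. y \<in># m \<Longrightarrow> y < x"
  shows "bij_betw (\<lambda>(R, i). R + replicate_mset i x)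
    (SIGMA R:second_rows m. {..min b (size m - 2 * size R)}) (second_rows (m + replicate_mset b x))"
    (is "bij_betw ?f ?S ?T")
proof -
  have x: "count m x = 0" using less by (meson count_inI less_irrefl)
  have sub: "R + replicate_mset i x \<subseteq># m + replicate_mset b x \<longleftrightarrow> R \<subseteq># m \<and> i \<le> b"
    if "x \<notin># R" for R i
  proof
    assume *: "R + replicate_mset i x \<subseteq># m + replicate_mset b x"
    show "R \<subseteq># m \<and> i \<le> b"
    proof
      show "R \<subseteq># m"
        unfolding subseteq_mset_def
      proof
        fix y
        show "count R y \<le> count m y"
          using * that mset_subset_eq_count[OF *, of y] x by (auto simp: not_in_iff split: if_splits)
      qed
      show "i \<le> b"
        using mset_subset_eq_count[OF *, of x] x by simp
    qed
  next
    assume "R \<subseteq># m \<and> i \<le> b"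
    then show "R + replicate_mset i x \<subseteq># m + replicate_mset b x"
      by (intro subset_mset.add_mono) (auto simp: subseteq_mset_def)
  qed
  have good: "R + replicate_mset i x \<in> ?T \<longleftrightarrow> R \<in> second_rows m \<and> i \<le> min b (size m - 2 * size R)"
    if "x \<notin># R" for R i
  proof (cases "R \<subseteq># m \<and> i \<le> b")
    case False
    then have "R + replicate_mset i x \<notin> ?T"
      using sub[OF that] unfolding second_rows_def by blast
    moreover have "\<not> (R \<in> second_rows m \<and> i \<le> min b (size m - 2 * size R))"
      using False unfolding second_rows_def min.bounded_iff by blast
    ultimately show ?thesis by blast
  next
    case True
    then have R: "\<And>y. y \<in># R \<Longrightarrow> y < x" using less by (meson mset_subset_eqD)
    have diff: "m + replicate_mset b x - (R + replicate_mset i x) = (m - R) + replicate_mset (b - i) x"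
    proof (rule multiset_eqI)
      fix y
      show "count (m + replicate_mset b x - (R + replicate_mset i x)) y =
          count ((m - R) + replicate_mset (b - i) x) y"
        using True mset_subset_eq_count[of R m y] by (simp add: add.commute)
    qed
    have 1: "size {#y \<in># R + replicate_mset i x. y \<le> z#} = size {#y \<in># R. y \<le> z#} + (if x \<le> z then i else 0)"
      for z by (simp add: size_filter_replicate_mset)
    have 2: "size {#y \<in># (m - R) + replicate_mset (b - i) x. y < z#} =
        size {#y \<in># m - R. y < z#} + (if x < z then b - i else 0)" for z
      by (simp add: size_filter_replicate_mset)
    have 3: "{#y \<in># R. y \<le> z#} = R" "{#y \<in># m - R. y < z#} = m - R" if "x \<le> z" for z
    proof -
      have "y < z" if "y \<in># m" for y
        using less[OF that] \<open>x \<le> z\<close> by (rule less_le_trans)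
      moreover have "y \<in># m" if "y \<in># R" for y
        using that True by (meson mset_subset_eqD)
      ultimately show "{#y \<in># R. y \<le> z#} = R" "{#y \<in># m - R. y < z#} = m - R"
        by (simp_all add: filter_mset_eq_conv less_imp_le in_diffD del: filter_diff_mset)
    qed
    have "R + replicate_mset i x \<in> ?T \<longleftrightarrow>
        (\<forall>z. size {#y \<in># R. y \<le> z#} + (if x \<le> z then i else 0) \<le>
          size {#y \<in># m - R. y < z#} + (if x < z then b - i else 0))" (is "_ \<longleftrightarrow> (\<forall>z. ?P z)")
      using True sub[OF that] by (simp only: second_rows_def mem_Collect_eq diff 1 2) simp
    \<comment> \<open>Beyond \<open>x\<close> the left side stays the same and the right side gains
      \<open>b - i\<close>, so those inequalities follow from the one at \<open>x\<close>.\<close>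
    also have "\<dots> \<longleftrightarrow> (\<forall>z<x. ?P z) \<and> ?P x"
    proof -
      have "?P z" if "?P x" "x < z" for z
        using that 3[of x] 3[of z] by simp
      then show ?thesis by (metis linorder_less_linear)
    qed
    also have "\<dots> \<longleftrightarrow> R \<in> second_rows m \<and> size R + i \<le> size (m - R)"
    proof -
      have "(\<forall>z<x. ?P z) \<longleftrightarrow> (\<forall>z<x. size {#y \<in># R. y \<le> z#} \<le> size {#y \<in># m - R. y < z#})"
        by auto
      moreover have "R \<in> second_rows m \<longleftrightarrow>
          (\<forall>z<x. size {#y \<in># R. y \<le> z#} \<le> size {#y \<in># m - R. y < z#}) \<and> size R \<le> size (m - R)"
        using True 3 unfolding second_rows_def mem_Collect_eq by (metis linorder_not_less order_refl)
      ultimately show ?thesis using 3[of x] by auto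
    qed
    also have "\<dots> \<longleftrightarrow> R \<in> second_rows m \<and> i \<le> min b (size m - 2 * size R)"
    proof -
      \<comment> \<open>This rules out truncation in \<open>size m - 2 * size R\<close>.\<close>
      have "size R \<le> size (m - R)" if "R \<in> second_rows m"
        using that 3[of x] unfolding second_rows_def by (metis (lifting) mem_Collect_eq order_refl)
      then show ?thesis
        using True by (auto simp: size_Diff_submset size_mset_mono)
    qed
    finally show ?thesis .
  qed
  have notin: "x \<notin># R" if "R \<in> second_rows m" for R
  proof
    assume "x \<in># R"
    moreover have "R \<subseteq># m" using that by (simp add: second_rows_def)
    ultimately have "x \<in># m" by (simp add: mset_subset_eqD)
    from less[OF this] show False by simp
  qed
  show ?thesis
  proof (rule bij_betw_imageI)
    show "inj_on ?f ?S"
    proof (rule inj_onI, clarify)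
      fix R i R' i'
      assume R: "R \<in> second_rows m" "R' \<in> second_rows m"
        and eq: "R + replicate_mset i x = R' + replicate_mset i' x"
      have "i = i'"
        using arg_cong[OF eq, of "\<lambda>M. count M x"] notin[OF R(1)] notin[OF R(2)]
        by (simp add: not_in_iff)
      with eq show "R = R' \<and> i = i'" by simp
    qed
    show "?f ` ?S = ?T"
    proof (intro equalityI subsetI)
      fix R assume R: "R \<in> ?T"
      define R' where "R' = {#y \<in># R. y \<noteq> x#}"
      have R': "R = R' + replicate_mset (count R x) x" "x \<notin># R'"
        by (auto simp: R'_def intro!: multiset_eqI)
      have "(R', count R x) \<in> ?S"
        using good[OF R'(2), of "count R x"] R R'(1) by simp
      then show "R \<in> ?f ` ?S" using R'(1) by (metis (mono_tags, lifting) case_prod_conv image_eqI)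
    qed (use good notin in \<open>auto simp del: min.bounded_iff\<close>)
  qed
qed

lemma finite_second_rows: "finite (second_rows m)"
proof (induction m rule: multiset_Max_induct)
  case (add m x b)
  show ?case
    using bij_betw_finite[OF second_rows_add[OF add(1)]] add(3) by blast
qed (simp add: second_rows_empty)

text \<open>At the largest element of \<open>R\<close>, the defining inequality compares all of
  \<open>R\<close> with a part of its complement.\<close>

lemma second_rows_size:
  fixes m :: "'a :: linorder multiset"
  assumes "R \<in> second_rows m"
  shows "2 * size R \<le> size m"
proof (cases "R = {#}")
  case False
  define x where "x = Max (set_mset R)"
  have R: "R \<subseteq># m" "size {#y \<in># R. y \<le> x#} \<le> size {#y \<in># m - R. y < x#}"
    using assms by (auto simp: second_rows_def)
  have "{#y \<in># R. y \<le> x#} = R"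
    by (simp add: filter_mset_eq_conv x_def)
  moreover have "size {#y \<in># m - R. y < x#} \<le> size m - size R"
    using R(1) by (metis size_Diff_submset size_filter_mset_lesseq)
  ultimately have "size R \<le> size m - size R" using R(2) by (metis order_trans)
  then show ?thesis using size_mset_mono[OF R(1)] by linarith
qed simp

text \<open>A new value multiplies the product by its path polynomial. The Clebsch-Gordan rule then
  sums over the same range of \<open>i\<close> as the Pieri rule, so both sides grow in
  step.\<close>

lemma second_rows_sum:
  fixes m :: "'a :: linorder multiset"
  shows "(\<Sum>R\<in>second_rows m. t ^ size R * path_poly (size m - 2 * size R)) =
    (\<Prod>x\<in>set_mset m. path_poly (count m x))"
proof (induction m rule: multiset_Max_induct)
  case (add m x b)
  let ?m = "m + replicate_mset b x"
  have "(\<Sum>R\<in>second_rows ?m. t ^ size R * path_poly (size ?m - 2 * size R)) =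
     (\<Sum>(R, i)\<in>(SIGMA R:second_rows m. {..min b (size m - 2 * size R)}).
        t ^ (size R + i) * path_poly (size m + b - 2 * (size R + i)))"
    by (subst sum.reindex_bij_betw[OF second_rows_add[OF add(1)], symmetric])
      (auto intro!: sum.cong)
  also have "\<dots> = (\<Sum>R\<in>second_rows m. \<Sum>i\<le>min b (size m - 2 * size R).
        t ^ (size R + i) * path_poly (size m + b - 2 * (size R + i)))"
    by (simp add: sum.Sigma finite_second_rows)
  also have "\<dots> = (\<Sum>R\<in>second_rows m. t ^ size R *
      (path_poly b * path_poly (size m - 2 * size R)))"
  proof (intro sum.cong refl)
    fix R assume "R \<in> second_rows m"
    \<comment> \<open>By this bound \<open>b + (size m - 2 * size R) - 2 * i\<close> equals
      \<open>size m + b - 2 * (size R + i)\<close> despite truncated subtraction.\<close>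
    then have "2 * size R \<le> size m" by (rule second_rows_size)
    then show "(\<Sum>i\<le>min b (size m - 2 * size R).
        t ^ (size R + i) * path_poly (size m + b - 2 * (size R + i))) =
        t ^ size R * (path_poly b * path_poly (size m - 2 * size R))"
      by (simp only: path_poly_mult sum_distrib_left)
        (auto intro!: sum.cong arg_cong[where f = path_poly] simp: power_add algebra_simps)
  qed
  also have "\<dots> = path_poly b * (\<Prod>y\<in>set_mset m. path_poly (count m y))"
    by (simp only: add(3)[symmetric] sum_distrib_left) (simp add: algebra_simps)
  also have "\<dots> = (\<Prod>y\<in>set_mset ?m. path_poly (count ?m y))"
  proof -
    have x: "x \<notin># m" using add(1) by blast
    then have "set_mset ?m = insert x (set_mset m)"
      using add(2) by auto
    moreover have "(\<Prod>y\<in>set_mset m. path_poly (count m y)) =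
        (\<Prod>y\<in>set_mset m. path_poly (count ?m y))"
      using x by (intro prod.cong) auto
    ultimately show ?thesis using x by (simp add: not_in_iff)
  qed
  finally show ?case .
qed (simp add: second_rows_empty)

section \<open>Tableaux of two-row shape\<close>

definition two_row :: "nat \<Rightarrow> nat \<Rightarrow> nat list" where
  "two_row n j = (if j = 0 then [n] else [n - j, j])"

text \<open>A downward closed property holds on an initial segment of a sorted list, and the filter
  measures its length.\<close>

lemma sorted_nth_iff_less_length_filter:
  assumes "sorted A" "j < length A" and down: "\<And>y z. P y \<Longrightarrow> z \<le> y \<Longrightarrow> P z"
  shows "P (A ! j) \<longleftrightarrow> j < length (filter P A)"
  using assms(1,2)
proof (induction A arbitrary: j)
  case (Cons a A)
  show ?case
  proof (cases "P a")
    case True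
    then show ?thesis using Cons by (cases j) auto
  next
    case False
    have "\<not> P y" if "y \<in> set (a # A)" for y
    proof -
      have "a \<le> y" using that Cons.prems(1) by auto
      then show ?thesis using False down by blast
    qed
    then have "filter P (a # A) = []" "\<not> P ((a # A) ! j)"
      using nth_mem[OF Cons.prems(2)] by (auto simp: filter_empty_conv)
    then show ?thesis by simp
  qed
qed simp

text \<open>The entries of \<open>B\<close> up to a threshold \<open>x\<close> fill the leftmost
  columns and must sit below entries of \<open>A\<close> smaller than \<open>x\<close>. In this form
  column strictness depends only on the contents of the rows.\<close>

lemma columns_strict_iff:
  fixes A B :: "'a :: linorder list"
  assumes "sorted A" "sorted B" "length B \<le> length A"
  shows "(\<forall>j<length B. A ! j < B ! j) \<longleftrightarrow>
    (\<forall>x. size {#y \<in># mset B. y \<le> x#} \<le> size {#y \<in># mset A. y < x#})"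
proof -
  have A: "A ! j < x \<longleftrightarrow> j < length (filter (\<lambda>y. y < x) A)" if "j < length A" for j x
    using sorted_nth_iff_less_length_filter[OF assms(1) that, of "\<lambda>y. y < x"] by auto
  have B: "B ! j \<le> x \<longleftrightarrow> j < length (filter (\<lambda>y. y \<le> x) B)" if "j < length B" for j x
    using sorted_nth_iff_less_length_filter[OF assms(2) that, of "\<lambda>y. y \<le> x"] by auto
  have "(\<forall>j<length B. A ! j < B ! j) \<longleftrightarrow>
    (\<forall>x. length (filter (\<lambda>y. y \<le> x) B) \<le> length (filter (\<lambda>y. y < x) A))"
  proof (intro iffI allI impI)
    fix x assume *: "\<forall>j<length B. A ! j < B ! j"
    show "length (filter (\<lambda>y. y \<le> x) B) \<le> length (filter (\<lambda>y. y < x) A)"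
    proof (cases "length (filter (\<lambda>y. y \<le> x) B)")
      case (Suc j)
      \<comment> \<open>\<open>j\<close> is the last column whose entry in \<open>B\<close> is at
        most \<open>x\<close>.\<close>
      then have "j < length B" using length_filter_le[of "\<lambda>y. y \<le> x" B] by simp
      with * B[of j x] Suc have "A ! j < x" by force
      then show ?thesis using A[of j x] \<open>j < length B\<close> assms(3) Suc by simp
    qed simp
  next
    fix j assume *: "\<forall>x. length (filter (\<lambda>y. y \<le> x) B) \<le> length (filter (\<lambda>y. y < x) A)"
      and j: "j < length B"
    \<comment> \<open>Column \<open>j\<close> is decided by the threshold
      \<open>B ! j\<close>.\<close>
    have "j < length (filter (\<lambda>y. y \<le> B ! j) B)" using B[OF j] by blast
    then have "j < length (filter (\<lambda>y. y < B ! j) A)" using * less_le_trans by blast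
    then show "A ! j < B ! j" using A[of j] j assms(3) by simp
  qed
  then show ?thesis by (simp flip: mset_filter)
qed

text \<open>Rows are sorted, so a tableau of content \<open>m\<close> is determined by the multiset
  in its second row. The bound on \<open>j\<close> keeps the second row no longer than the first, as
  \<open>columns_strict_iff\<close> requires.\<close>

lemma schur_two_row:
  assumes "2 * j \<le> n"
  shows "schur (two_row n j) m =
    (if size m = n then int (card {R \<in> second_rows m. size R = j}) else 0)"
proof -
  let ?T = "{T \<in> SSYT (two_row n j). mset (concat T) = m}"
  have size: "size m = n" if "T \<in> ?T" for T
  proof -
    have "size m = sum_list (map length T)" using that by (auto simp: length_concat)
    also have "\<dots> = n" using that assms by (simp add: SSYT_def two_row_def split: if_splits)
    finally show ?thesis .
  qed
  have "card ?T = card {R \<in> second_rows m. size R = j}" if n: "size m = n"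
  proof (cases "j = 0")
    case True
    have "?T = {[sorted_list_of_multiset m]}"
    proof (intro equalityI subsetI)
      fix T assume T: "T \<in> ?T"
      then obtain A where A: "T = [A]" "sorted A"
        using True by (auto simp: SSYT_def two_row_def length_Suc_conv map_eq_Cons_conv)
      with T have "A = sorted_list_of_multiset m"
        by (auto simp: sorted_sort_id)
      then show "T \<in> {[sorted_list_of_multiset m]}" using A by simp
    next
      fix T assume "T \<in> {[sorted_list_of_multiset m]}"
      then show "T \<in> ?T" using True n by (auto simp: SSYT_def two_row_def simp flip: size_mset)
    qed
    moreover have "{R \<in> second_rows m. size R = j} = {{#}}"
      using True by (auto simp: second_rows_def)
    ultimately show ?thesis by simp
  next
    case False
    let ?f = "\<lambda>R. [sorted_list_of_multiset (m - R), sorted_list_of_multiset R]"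
    have mem: "[A, B] \<in> SSYT (two_row n j) \<longleftrightarrow> length A = n - j \<and> length B = j \<and>
        sorted A \<and> sorted B \<and> (\<forall>j<length B. A ! j < B ! j)" for A B
      using False by (auto simp: SSYT_def two_row_def less_Suc_eq)
    have sized: "length (sorted_list_of_multiset M) = size M" for M :: "nat multiset"
      by (metis mset_sorted_list_of_multiset size_mset)
    have "?T = ?f ` {R \<in> second_rows m. size R = j}"
    proof (intro equalityI subsetI)
      fix T assume T: "T \<in> ?T"
      then obtain A B where AB: "T = [A, B]"
        using False by (auto simp: SSYT_def two_row_def map_eq_Cons_conv)
      with T have T': "length A = n - j" "length B = j" "sorted A" "sorted B"
          "\<forall>j<length B. A ! j < B ! j" "mset A + mset B = m"
        using mem[of A B] by auto
      have diff: "m - mset B = mset A" using T'(6) by auto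
      have "mset B \<in> second_rows m"
        using columns_strict_iff[of A B] T' assms diff
        unfolding second_rows_def by auto
      moreover have "T = ?f (mset B)"
        using AB T' diff by (simp add: sorted_sort_id)
      ultimately show "T \<in> ?f ` {R \<in> second_rows m. size R = j}" using T'(2) by auto
    next
      fix T assume "T \<in> ?f ` {R \<in> second_rows m. size R = j}"
      then obtain R where R: "R \<in> second_rows m" "size R = j" "T = ?f R" by auto
      have "R \<subseteq># m" using R(1) by (simp add: second_rows_def)
      then have "size (m - R) = n - j" using n R(2) by (simp add: size_Diff_submset)
      then show "T \<in> ?T"
        using R columns_strict_iff[of "sorted_list_of_multiset (m - R)" "sorted_list_of_multiset R"]
          assms \<open>R \<subseteq># m\<close>
        unfolding R(3) mem_Collect_eq mem by (simp add: sized second_rows_def)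
    qed
    moreover have "inj ?f"
      by (intro injI) (metis list.inject mset_sorted_list_of_multiset)
    ultimately show ?thesis by (simp add: card_image inj_on_subset)
  qed
  moreover have "card ?T = 0" if "size m \<noteq> n"
  proof -
    have "?T = {}" using size that by blast
    then show ?thesis by (simp only: card.empty)
  qed
  ultimately have "card ?T = (if size m = n then card {R \<in> second_rows m. size R = j} else 0)"
    by simp
  then show ?thesis unfolding schur_def weight_series_def by simp
qed

text \<open>A monomial comes from exactly one weakly increasing word, so every coefficient is 0 or
  1.\<close>

lemma fundamental_eq:
  "fundamental n J m = (if size m = n \<and>
     (\<forall>j\<in>J. sorted_list_of_multiset m ! (j - 1) < sorted_list_of_multiset m ! j) then 1 else 0)"
proof -
  have "{is \<in> {is. length is = n \<and> sorted is \<and> (\<forall>j\<in>J. is ! (j - 1) < is ! j)}. mset is = m} =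
    (if size m = n \<and>
     (\<forall>j\<in>J. sorted_list_of_multiset m ! (j - 1) < sorted_list_of_multiset m ! j)
     then {sorted_list_of_multiset m} else {})"
    by (auto simp: sorted_sort_id simp flip: size_mset)
  then show ?thesis unfolding fundamental_def weight_series_def by simp
qed

section \<open>Statistics with sparse values\<close>

text \<open>What the symmetric function side uses about the partitions: \<open>P\<close> stands for
  either family and \<open>D\<close> for the descent set. That \<open>h\<close> sees only the size
  of \<open>J\<close> is the source of symmetry.\<close>

locale sparse_statistic =
  fixes P :: "'a set" and D :: "'a \<Rightarrow> nat set" and n :: nat and h :: "nat \<Rightarrow> nat"
  assumes finite_P: "finite P"
    and n_pos: "1 \<le> n"
    and D_subset: "p \<in> P \<Longrightarrow> D p \<subseteq> {1..<n}"
    and D_sparse: "p \<in> P \<Longrightarrow> i \<in> D p \<Longrightarrow> Suc i \<notin> D p"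
    and card_supersets: "J \<subseteq> {1..<n} \<Longrightarrow> (\<And>i. i \<in> J \<Longrightarrow> Suc i \<notin> J) \<Longrightarrow>
      card {p \<in> P. J \<subseteq> D p} = h (card J)"
begin

text \<open>The linear functional with \<open>t ^ r \<mapsto> h r\<close>.\<close>

definition moment :: "int poly \<Rightarrow> int" where
  "moment q = (\<Sum>r<n. coeff q r * int (h r))"

lemma moment_diff: "moment (q - q') = moment q - moment q'"
  by (simp add: moment_def algebra_simps sum_subtractf)

lemma moment_sum: "moment (\<Sum>a\<in>A. f a) = (\<Sum>a\<in>A. moment (f a))"
  unfolding moment_def coeff_sum sum_distrib_right by (rule sum.swap)

lemma moment_power: "r < n \<Longrightarrow> moment (t ^ r) = int (h r)"
proof -
  assume "r < n"
  have "t ^ r = monom 1 r" by (simp add: monom_power)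
  then show ?thesis using \<open>r < n\<close> by (simp add: moment_def if_distrib[of "\<lambda>x. x * _"] cong: if_cong)
qed

text \<open>The list is read backwards because the recursion of \<^const>\<open>list_poly\<close> removes the
  positions furthest to the right.\<close>

definition no_plateau_descent :: "'b list \<Rightarrow> 'a \<Rightarrow> bool" where
  "no_plateau_descent l p \<longleftrightarrow> (\<forall>i\<in>D p. i < length l \<longrightarrow> rev l ! (i - 1) \<noteq> rev l ! i)"

text \<open>Prepending to \<open>l\<close> appends to the word \<open>rev l\<close>, so the only new
  condition is at index \<open>length l\<close>.\<close>

lemma no_plateau_descent_Cons:
  assumes "l \<noteq> []"
  shows "no_plateau_descent (x # l) p \<longleftrightarrow>
    no_plateau_descent l p \<and> (length l \<in> D p \<longrightarrow> hd l \<noteq> x)"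
proof -
  have nth: "rev (x # l) ! i = rev l ! i" if "i < length l" for i
    using that by (simp add: nth_append)
  have last: "rev (x # l) ! length l = x" "rev (x # l) ! (length l - 1) = hd l"
    using assms by (simp_all add: nth_append rev_nth hd_conv_nth)
  have "no_plateau_descent (x # l) p \<longleftrightarrow>
      (\<forall>i\<in>D p. i < length l \<longrightarrow> rev (x # l) ! (i - 1) \<noteq> rev (x # l) ! i) \<and>
      (length l \<in> D p \<longrightarrow> rev (x # l) ! (length l - 1) \<noteq> rev (x # l) ! length l)"
    unfolding no_plateau_descent_def by (simp only: list.size) (metis add.right_neutral add_Suc_right less_Suc_eq)
  also have "\<dots> \<longleftrightarrow> no_plateau_descent l p \<and> (length l \<in> D p \<longrightarrow> hd l \<noteq> x)"
    unfolding no_plateau_descent_def last using nth by (metis less_imp_diff_less)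
  finally show ?thesis .
qed

text \<open>Inclusion and exclusion along the recursion of \<open>list_poly\<close>. If the word
  ends in two equal letters, the elements with a descent there are subtracted; that descent joins
  the set \<open>J\<close> of forced descents, which lies to the right of the positions still to be
  treated.\<close>

lemma card_no_plateau_descent:
  assumes "length l \<le> n" "J \<subseteq> {Suc (length l)..<n}" "\<And>i. i \<in> J \<Longrightarrow> Suc i \<notin> J"
  shows "int (card {p \<in> P. J \<subseteq> D p \<and> no_plateau_descent l p}) = moment (t ^ card J * list_poly l)"
proof -
  have base: "int (card {p \<in> P. J \<subseteq> D p \<and> no_plateau_descent l p}) = moment (t ^ card J * 1)"
    if "length l \<le> 1" "J \<subseteq> {1..<n}" "\<And>i. i \<in> J \<Longrightarrow> Suc i \<notin> J" for J and l :: "'b list"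
  proof -
    have "no_plateau_descent l p" if "p \<in> P" for p
      using D_subset[OF that] \<open>length l \<le> 1\<close> by (force simp: no_plateau_descent_def)
    then have "{p \<in> P. J \<subseteq> D p \<and> no_plateau_descent l p} = {p \<in> P. J \<subseteq> D p}" by blast
    \<comment> \<open>This keeps the power of \<open>t\<close> within the range summed by
      \<open>moment\<close>.\<close>
    moreover have "card J < n"
      using card_mono[OF _ that(2)] n_pos by simp
    ultimately show ?thesis using card_supersets[OF that(2,3)] moment_power by simp
  qed
  show ?thesis
    using assms
  proof (induction l arbitrary: J rule: list_poly.induct)
    case 1
    have "J \<subseteq> {1..<n}" using 1 by auto
    then show ?case using base[of "[]" J] 1(3) by simp
  next
    case (2 x)
    have "J \<subseteq> {1..<n}" using 2 by auto
    then show ?case using base[of "[x]" J] 2(3) by simp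
  next
    case (3 x y l)
    define a where "a = length l"
    have J: "Suc (Suc (Suc a)) \<le> i" "i < n" if "i \<in> J" for i
      using that 3(4) by (auto simp: a_def)
    have split: "no_plateau_descent (x # y # l) p \<longleftrightarrow>
        no_plateau_descent (y # l) p \<and> (x = y \<longrightarrow> Suc a \<notin> D p)" for p
      using no_plateau_descent_Cons[of "y # l" x p] by (auto simp: a_def)
    \<comment> \<open>By sparseness a descent at \<open>Suc a\<close> excludes one at
      \<open>a\<close>, so the letter \<open>y\<close> imposes no condition.\<close>
    have drop: "no_plateau_descent (y # l) p \<longleftrightarrow> no_plateau_descent l p"
      if "p \<in> P" "Suc a \<in> D p" for p
    proof (cases "l = []")
      case True
      then show ?thesis using D_subset[OF that(1)] by (auto simp: no_plateau_descent_def)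
    next
      case False
      have "length l \<notin> D p" using D_sparse[OF that(1)] that(2) by (auto simp: a_def)
      then show ?thesis using no_plateau_descent_Cons[OF False] by simp
    qed
    have IH1: "int (card {p \<in> P. J \<subseteq> D p \<and> no_plateau_descent (y # l) p}) =
        moment (t ^ card J * list_poly (y # l))"
    proof (rule 3(1))
      show "J \<subseteq> {Suc (length (y # l))..<n}" using 3(4) by auto
    qed (use 3(3,5) in auto)
    show ?case
    proof (cases "x = y")
      case False
      then show ?thesis using IH1 by (simp add: split)
    next
      case True
      let ?J = "insert (Suc a) J"
      have IH2: "int (card {p \<in> P. ?J \<subseteq> D p \<and> no_plateau_descent l p}) =
          moment (t ^ card ?J * list_poly l)"
      proof (rule 3(2)[OF True])
        show "length l \<le> n" using 3(3) by simp
        show "?J \<subseteq> {Suc (length l)..<n}" using J 3(3) by (force simp: a_def)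
        \<comment> \<open>Elements of \<open>J\<close> are at least \<open>a + 3\<close>, so the new
          element \<open>a + 1\<close> has no neighbour in \<open>J\<close>.\<close>
        show "Suc i \<notin> ?J" if "i \<in> ?J" for i
          using that J[of "Suc i"] J[of i] 3(5)[of i] by auto
      qed
      have "Suc a \<notin> J" using J(1) by fastforce
      moreover have "finite J" using 3(4) finite_subset by blast
      ultimately have card_J: "card ?J = Suc (card J)" by simp
      have "{p \<in> P. J \<subseteq> D p \<and> no_plateau_descent (x # y # l) p} =
          {p \<in> P. J \<subseteq> D p \<and> no_plateau_descent (y # l) p} -
          {p \<in> P. ?J \<subseteq> D p \<and> no_plateau_descent l p}"
        using split drop True by blast
      moreover have "{p \<in> P. ?J \<subseteq> D p \<and> no_plateau_descent l p} \<subseteq>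
          {p \<in> P. J \<subseteq> D p \<and> no_plateau_descent (y # l) p}"
        using drop by blast
      ultimately have "int (card {p \<in> P. J \<subseteq> D p \<and> no_plateau_descent (x # y # l) p}) =
          int (card {p \<in> P. J \<subseteq> D p \<and> no_plateau_descent (y # l) p}) -
          int (card {p \<in> P. ?J \<subseteq> D p \<and> no_plateau_descent l p})"
        using finite_P by (simp add: card_Diff_subset card_mono of_nat_diff)
      also have "\<dots> = moment (t ^ card J * list_poly (y # l) - t ^ Suc (card J) * list_poly l)"
        by (simp only: IH1 IH2 card_J moment_diff)
      also have "t ^ card J * list_poly (y # l) - t ^ Suc (card J) * list_poly l =
          t ^ card J * list_poly (x # y # l)"
        using True by (simp add: algebra_simps)
      finally show ?thesis .
    qed
  qed
qed

section \<open>Symmetry and Schur expansion of the quasisymmetric function\<close>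

definition Q :: series where
  "Q = (\<lambda>m. \<Sum>p\<in>P. fundamental n (D p) m)"

text \<open>The coefficient counts the elements with no descent inside a run of the sorted word of
  \<open>m\<close>. This is \<open>card_no_plateau_descent\<close> without forced descents, and the
  polynomial factors over the runs.\<close>

lemma Q_eq_moment:
  "Q m = (if size m = n then moment (\<Prod>x\<in>set_mset m. path_poly (count m x)) else 0)"
proof (cases "size m = n")
  case True
  let ?l = "sorted_list_of_multiset m"
  have len: "length ?l = n" using True by (metis mset_sorted_list_of_multiset size_mset)
  \<comment> \<open>In a weakly increasing word, a strict ascent is the same as a change of
    letter.\<close>
  have asc: "?l ! (i - 1) < ?l ! i \<longleftrightarrow> ?l ! (i - 1) \<noteq> ?l ! i" if "p \<in> P" "i \<in> D p" for p i
    using sorted_nth_mono[OF sorted_sorted_list_of_multiset, of "i - 1" i m] D_subset[OF that(1)] that(2) len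
    by fastforce
  have "Q m = (\<Sum>p\<in>P. if no_plateau_descent (rev ?l) p then 1 else 0)"
    unfolding Q_def
  proof (intro sum.cong refl)
    fix p assume p: "p \<in> P"
    have "(\<forall>i\<in>D p. ?l ! (i - 1) < ?l ! i) \<longleftrightarrow> no_plateau_descent (rev ?l) p"
      using asc[OF p] D_subset[OF p] len by (force simp: no_plateau_descent_def)
    then show "fundamental n (D p) m = (if no_plateau_descent (rev ?l) p then 1 else 0)"
      using True by (simp add: fundamental_eq)
  qed
  also have "\<dots> = int (card {p \<in> P. {} \<subseteq> D p \<and> no_plateau_descent (rev ?l) p})"
    using finite_P by (simp add: sum.If_cases Int_def conj_commute)
  also have "\<dots> = moment (t ^ card ({} :: nat set) * list_poly (rev ?l))"
    by (rule card_no_plateau_descent) (simp_all add: len)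
  finally show ?thesis using True by (simp add: list_poly_rev_sorted)
qed (simp add: Q_def fundamental_eq)

text \<open>The product in \<open>Q_eq_moment\<close> depends only on the multiplicities, which a
  bijection of the variables merely permutes.\<close>

lemma symmetric_Q: "symmetric_function Q"
  unfolding symmetric_function_def
proof (intro conjI allI impI exI[of _ n])
  fix m assume "Q m \<noteq> 0"
  then show "size m \<le> n" by (simp add: Q_eq_moment split: if_splits)
next
  fix \<pi> :: "nat \<Rightarrow> nat" and m :: monomial
  assume "bij \<pi>"
  then have inj: "inj \<pi>" by (rule bij_is_inj)
  have count: "count (image_mset \<pi> m) (\<pi> x) = count m x" for x
    using inj by (induction m) (auto simp: inj_eq)
  have "(\<Prod>x\<in>set_mset (image_mset \<pi> m). path_poly (count (image_mset \<pi> m) x)) =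
      (\<Prod>x\<in>set_mset m. path_poly (count m x))"
    using inj by (simp add: prod.reindex inj_on_subset count)
  then show "Q (image_mset \<pi> m) = Q m" by (simp add: Q_eq_moment)
qed

definition schur_coeff :: "nat \<Rightarrow> int" where
  "schur_coeff j = moment (t ^ j * path_poly (n - 2 * j))"

text \<open>The coefficient counts the elements with descent set \<open>{n - 1, n - 3, \<dots>, n - 2 * j + 1}\<close>.\<close>

lemma schur_coeff_nonneg:
  assumes "2 * j \<le> n"
  shows "0 \<le> schur_coeff j"
proof -
  \<comment> \<open>The constant word forbids every descent below \<open>n - 2 * j\<close>. The
    other indices outside \<open>?J\<close> are neighbours of elements of \<open>?J\<close>, so
    sparseness excludes them.\<close>
  let ?J = "(\<lambda>i. n - 2 * i - 1) ` {..<j}" and ?l = "replicate (n - 2 * j) (0 :: nat)"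
  have "inj_on (\<lambda>i. n - 2 * i - 1) {..<j}"
    using assms by (auto simp: inj_on_def)
  then have card: "card ?J = j" by (simp add: card_image)
  have "int (card {p \<in> P. ?J \<subseteq> D p \<and> no_plateau_descent ?l p}) =
      moment (t ^ card ?J * list_poly ?l)"
  proof (rule card_no_plateau_descent)
    show "?J \<subseteq> {Suc (length ?l)..<n}" using assms by auto
    show "Suc i \<notin> ?J" if i: "i \<in> ?J" for i
    proof
      assume "Suc i \<in> ?J"
      then obtain b where b: "b < j" "Suc i = n - 2 * b - 1" by blast
      obtain a where a: "a < j" "i = n - 2 * a - 1" using i by blast
      \<comment> \<open>Both \<open>i\<close> and \<open>Suc i\<close> would have the parity of
        \<open>n - 1\<close>.\<close>
      have "i + 2 * a + 1 = n" "Suc i + 2 * b + 1 = n" using a b assms by linarith+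
      then show False by presburger
    qed
  qed simp
  then have "schur_coeff j = int (card {p \<in> P. ?J \<subseteq> D p \<and> no_plateau_descent ?l p})"
    by (simp only: schur_coeff_def card list_poly_replicate)
  then show ?thesis by simp
qed

text \<open>\<open>second_rows_sum\<close> rewrites the product in \<open>Q_eq_moment\<close> as a
  sum over second rows. Those of size \<open>j\<close> contribute equally, and their number is the
  coefficient of a two-row Schur function.\<close>

lemma Q_schur_expansion:
  "Q m = (\<Sum>j | 2 * j \<le> n. schur_coeff j * schur (two_row n j) m)"
proof (cases "size m = n")
  case True
  have le: "2 * size R \<le> n" if "R \<in> second_rows m" for R
    using second_rows_size[OF that] True by simp
  have "Q m = (\<Sum>R\<in>second_rows m. schur_coeff (size R))"
    using True by (simp add: Q_eq_moment schur_coeff_def moment_sum flip: second_rows_sum)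
  also have "\<dots> = (\<Sum>j | 2 * j \<le> n. \<Sum>R | R \<in> second_rows m \<and> size R = j. schur_coeff (size R))"
  proof (rule sum.group[symmetric])
    show "finite {j. 2 * j \<le> n}" by (rule finite_subset[of _ "{..n}"]) auto
  qed (use le in \<open>auto simp: finite_second_rows\<close>)
  also have "\<dots> = (\<Sum>j | 2 * j \<le> n. schur_coeff j * schur (two_row n j) m)"
    using True by (intro sum.cong refl) (simp add: schur_two_row)
  finally show ?thesis .
qed (simp add: Q_eq_moment schur_two_row)

lemma schur_positive_Q: "schur_positive Q"
proof -
  let ?S = "two_row n ` {j. 2 * j \<le> n}"
  have fin: "finite {j. 2 * j \<le> n}" by (rule finite_subset[of _ "{..n}"]) auto
  \<comment> \<open>The sum of the tail reads \<open>j\<close> off the shape, also for the one-row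
    shape with \<open>j = 0\<close>.\<close>
  define c where "c lam = (if lam \<in> ?S then schur_coeff (sum_list (tl lam)) else 0)" for lam
  have tl: "sum_list (tl (two_row n j)) = j" for j by (simp add: two_row_def)
  have inj: "inj_on (two_row n) {j. 2 * j \<le> n}"
    by (rule inj_onI) (metis tl)
  have "schur_expansion Q c"
    unfolding schur_expansion_def
  proof (intro conjI ext)
    have sub: "{lam. c lam \<noteq> 0} \<subseteq> ?S" by (auto simp: c_def)
    then show "finite {lam. c lam \<noteq> 0}" using fin finite_subset by blast
    \<comment> \<open>\<open>two_row\<close> leaves out a second part 0, and \<open>n_pos\<close>
      excludes the shape \<open>[0]\<close>.\<close>
    have "int_partition (two_row n j)" if "2 * j \<le> n" for j
      using that n_pos by (auto simp: int_partition_def two_row_def)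
    with sub show "{lam. c lam \<noteq> 0} \<subseteq> Collect int_partition" by blast
    fix m
    have "(\<Sum>lam | c lam \<noteq> 0. c lam * schur lam m) = (\<Sum>lam\<in>?S. c lam * schur lam m)"
      using fin sub by (intro sum.mono_neutral_left) auto
    also have "\<dots> = (\<Sum>j | 2 * j \<le> n. c (two_row n j) * schur (two_row n j) m)"
      by (simp add: sum.reindex[OF inj])
    also have "\<dots> = Q m"
      unfolding Q_schur_expansion by (intro sum.cong refl) (auto simp: c_def tl)
    finally show "Q m = (\<Sum>lam | c lam \<noteq> 0. c lam * schur lam m)" by (rule sym)
  qed
  moreover have "0 \<le> c lam" for lam
    using schur_coeff_nonneg by (auto simp: c_def tl)
  ultimately show ?thesis using symmetric_Q by (auto simp: schur_positive_def)
qed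

end

section \<open>Contraction of twins\<close>

text \<open>Relabels the vertices when \<open>Suc i\<close> is merged into \<open>i\<close>;
  \<open>expand i\<close> is the section that avoids \<open>Suc i\<close>.\<close>

definition collapse :: "nat \<Rightarrow> nat \<Rightarrow> nat" where
  "collapse i v = (if v \<le> i then v else v - 1)"

definition expand :: "nat \<Rightarrow> nat \<Rightarrow> nat" where
  "expand i v = (if v \<le> i then v else Suc v)"

lemma collapse_expand: "collapse i (expand i v) = v"
  by (simp add: collapse_def expand_def)

lemma expand_collapse: "v \<noteq> Suc i \<Longrightarrow> expand i (collapse i v) = v"
  by (auto simp: collapse_def expand_def)

lemma expand_less_iff: "expand i u < expand i v \<longleftrightarrow> u < v"
  by (auto simp: expand_def)

lemma collapse_less_iff: "u < v \<Longrightarrow> collapse i u < collapse i v \<longleftrightarrow> \<not> (u = i \<and> v = Suc i)"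
  by (auto simp: collapse_def)

lemma expand_bounds: "1 \<le> i \<Longrightarrow> i \<le> n \<Longrightarrow> 1 \<le> v \<Longrightarrow> v \<le> n \<Longrightarrow> 1 \<le> expand i v \<and> expand i v \<le> Suc n"
  by (auto simp: expand_def)

lemma collapse_bounds: "1 \<le> i \<Longrightarrow> i \<le> n \<Longrightarrow> 1 \<le> v \<Longrightarrow> v \<le> Suc n \<Longrightarrow> 1 \<le> collapse i v \<and> collapse i v \<le> n"
  by (auto simp: collapse_def)

text \<open>
  The parameter \<open>edge\<close> is the encoding of the edges \<open>(u, v)\<close> with \<open>u < v\<close>. The flag \<open>gallai\<close>
  admits triangles in which the short edges \<open>(u, v)\<close> and \<open>(v, w)\<close> share a block that does
  not contain \<open>(u, w)\<close>; this is the only difference between the two kinds of partitions.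
\<close>

locale edge_colouring =
  fixes edge :: "nat \<Rightarrow> nat \<Rightarrow> 'e" and gallai :: bool
  assumes edge_inject: "\<lbrakk>u < v; u' < v'; edge u v = edge u' v'\<rbrakk> \<Longrightarrow> u = u' \<and> v = v'"
begin

section \<open>Edge partitions defined by triangles\<close>

definition edges :: "nat \<Rightarrow> 'e set" where
  "edges n = {edge u v | u v. 1 \<le> u \<and> u < v \<and> v \<le> n}"

definition triangle :: "'e set set \<Rightarrow> nat \<Rightarrow> nat \<Rightarrow> nat \<Rightarrow> bool" where
  "triangle p u v w \<longleftrightarrow> (\<exists>B\<in>p. edge u w \<in> B \<and> (edge u v \<in> B \<or> edge v w \<in> B) \<or>
     gallai \<and> edge u v \<in> B \<and> edge v w \<in> B)"

definition colourings :: "nat \<Rightarrow> nat \<Rightarrow> 'e set set set" where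
  "colourings n k = {p. partition_on (edges n) p \<and> card p = k \<and>
     (\<forall>u v w. 1 \<le> u \<longrightarrow> u < v \<longrightarrow> v < w \<longrightarrow> w \<le> n \<longrightarrow> triangle p u v w)}"

text \<open>The preimage of a block under the vertex map \<open>g\<close>; the condition
  \<open>g u < g v\<close> drops the edge that \<open>collapse\<close> shrinks to a point.\<close>

definition pull :: "(nat \<Rightarrow> nat) \<Rightarrow> nat \<Rightarrow> 'e set \<Rightarrow> 'e set" where
  "pull g n B = {edge u v | u v. 1 \<le> u \<and> u < v \<and> v \<le> n \<and> g u < g v \<and> edge (g u) (g v) \<in> B}"

lemma edge_in_edges: "u < v \<Longrightarrow> edge u v \<in> edges n \<longleftrightarrow> 1 \<le> u \<and> v \<le> n"
  unfolding edges_def by (auto dest: edge_inject)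

lemma edge_in_pull:
  "u < v \<Longrightarrow> edge u v \<in> pull g n B \<longleftrightarrow> 1 \<le> u \<and> v \<le> n \<and> g u < g v \<and> edge (g u) (g v) \<in> B"
  unfolding pull_def by (auto dest: edge_inject)

lemma edgesE:
  assumes "e \<in> edges n"
  obtains u v where "e = edge u v" "1 \<le> u" "u < v" "v \<le> n"
  using assms unfolding edges_def by blast

lemma edges_subset_eqI:
  assumes "B \<subseteq> edges n" "C \<subseteq> edges n"
    and "\<And>u v. \<lbrakk>1 \<le> u; u < v; v \<le> n\<rbrakk> \<Longrightarrow> edge u v \<in> B \<longleftrightarrow> edge u v \<in> C"
  shows "B = C"
proof (intro equalityI subsetI)
  fix e assume "e \<in> B"
  then show "e \<in> C" using assms by (metis edgesE subsetD)
next
  fix e assume "e \<in> C"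
  then show "e \<in> B" using assms by (metis edgesE subsetD)
qed

lemma pull_subset: "pull g n B \<subseteq> edges n"
  unfolding pull_def edges_def by blast

lemma pull_disjoint: "B \<inter> C = {} \<Longrightarrow> pull g n B \<inter> pull g n C = {}"
  unfolding pull_def using edge_inject by blast

lemma finite_edges: "finite (edges n)"
proof -
  have "edges n \<subseteq> (\<lambda>(u, v). edge u v) ` ({..n} \<times> {..n})"
    unfolding edges_def by force
  then show ?thesis using finite_subset by blast
qed

lemma finite_colourings: "finite (colourings n k)"
proof -
  have "colourings n k \<subseteq> Pow (Pow (edges n))"
    unfolding colourings_def partition_on_def by blast
  then show ?thesis using finite_edges by (meson finite_Pow_iff finite_subset)
qed

lemma finite_colouring: "p \<in> colourings n k \<Longrightarrow> finite p"
  unfolding colourings_def using finite_edges finite_elements by blast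

lemma colouring_triangle:
  "\<lbrakk>p \<in> colourings n k; 1 \<le> u; u < v; v < w; w \<le> n\<rbrakk> \<Longrightarrow> triangle p u v w"
  unfolding colourings_def by blast

lemma colouring_block_eq:
  "\<lbrakk>p \<in> colourings n k; B \<in> p; C \<in> p; e \<in> B; e \<in> C\<rbrakk> \<Longrightarrow> B = C"
  unfolding colourings_def partition_on_def disjoint_def by blast

lemma colouring_block_subset: "\<lbrakk>p \<in> colourings n k; B \<in> p\<rbrakk> \<Longrightarrow> B \<subseteq> edges n"
  unfolding colourings_def partition_on_def by blast

section \<open>Doubling a vertex into twins and contracting them again\<close>

definition blow_up :: "nat \<Rightarrow> nat \<Rightarrow> 'e set set \<Rightarrow> 'e set set" where
  "blow_up n i p = insert {edge i (Suc i)} (pull (collapse i) (Suc n) ` p)"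

text \<open>Undoes \<open>blow_up\<close>, which doubles vertex \<open>i\<close> into twins joined
  by a new singleton block: that block goes, and the others are restricted to the vertices other
  than \<open>Suc i\<close>.\<close>

definition contract :: "nat \<Rightarrow> nat \<Rightarrow> 'e set set \<Rightarrow> 'e set set" where
  "contract n i p = pull (expand i) n ` (p - {{edge i (Suc i)}})"

context
  fixes n i :: nat
  assumes i: "1 \<le> i" "i \<le> n"
begin

lemma pull_expand_collapse:
  assumes "B \<subseteq> edges n"
  shows "pull (expand i) n (pull (collapse i) (Suc n) B) = B"
proof (rule edges_subset_eqI[OF pull_subset assms])
  fix u v assume uv: "1 \<le> u" "u < v" "v \<le> n"
  then have "expand i u < expand i v" "1 \<le> expand i u" "expand i v \<le> Suc n"
    using i expand_bounds by (auto simp: expand_less_iff)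
  then show "edge u v \<in> pull (expand i) n (pull (collapse i) (Suc n) B) \<longleftrightarrow> edge u v \<in> B"
    using uv by (simp add: edge_in_pull collapse_expand)
qed

lemma singleton_notin_pull: "edge i (Suc i) \<notin> pull (collapse i) (Suc n) B"
  by (simp add: edge_in_pull collapse_def)

text \<open>A triangle through both twins has two edges pulled back from the same edge, one of them
  its long edge, so the condition holds for either value of \<open>gallai\<close>.
  \<open>collapse\<close> carries every other triangle to a triangle.\<close>

lemma blow_up_colouring:
  assumes p: "p \<in> colourings n k"
  shows "blow_up n i p \<in> colourings (Suc n) (Suc k)"
proof -
  let ?f = "pull (collapse i) (Suc n)"
  have part: "partition_on (edges n) p" and card: "card p = k"
    using p by (auto simp: colourings_def)
  have inv: "pull (expand i) n (?f B) = B" if "B \<in> p" for B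
    using pull_expand_collapse colouring_block_subset[OF p that] by blast
  have inj: "inj_on ?f p" by (rule inj_on_inverseI[where g = "pull (expand i) n"], rule inv)
  have notin: "{edge i (Suc i)} \<notin> ?f ` p" using singleton_notin_pull by blast
  have in_union: "edge u v \<in> \<Union> (?f ` p)"
    if "1 \<le> u" "u < v" "v \<le> Suc n" "\<not> (u = i \<and> v = Suc i)" for u v
  proof -
    have "collapse i u < collapse i v" using that collapse_less_iff by blast
    moreover have "1 \<le> collapse i u" "collapse i v \<le> n"
      using that i collapse_bounds by auto
    ultimately have "edge (collapse i u) (collapse i v) \<in> \<Union> p"
      using part by (simp add: partition_on_def edge_in_edges)
    then show ?thesis using that \<open>collapse i u < collapse i v\<close> by (auto simp: edge_in_pull)
  qed
  have "partition_on (edges (Suc n)) (blow_up n i p)"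
  proof (rule partition_onI)
    show "\<Union> (blow_up n i p) = edges (Suc n)"
    proof (rule edges_subset_eqI[OF _ subset_refl])
      show "\<Union> (blow_up n i p) \<subseteq> edges (Suc n)"
        using pull_subset i by (auto simp: blow_up_def edge_in_edges)
      show "edge u v \<in> \<Union> (blow_up n i p) \<longleftrightarrow> edge u v \<in> edges (Suc n)"
        if "1 \<le> u" "u < v" "v \<le> Suc n" for u v
        using in_union[OF that] that by (auto simp: blow_up_def edge_in_edges)
    qed
    \<comment> \<open>A pulled back block is nonempty because restricting it recovers the block it
      came from.\<close>
    have "B \<noteq> {}" if B: "B \<in> blow_up n i p" for B
    proof (cases "B = {edge i (Suc i)}")
      case False
      then obtain C where C: "C \<in> p" "B = ?f C" using B by (auto simp: blow_up_def)
      have "C \<noteq> {}" using C(1) part by (auto simp: partition_on_def)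
      moreover have "pull (expand i) n {} = {}" by (simp add: pull_def)
      ultimately show ?thesis using inv[OF C(1)] C(2) by metis
    qed simp
    then show "{} \<notin> blow_up n i p" by blast
    show "disjnt B C" if "B \<in> blow_up n i p" "C \<in> blow_up n i p" "B \<noteq> C" for B C
    proof -
      have "disjnt (?f B') (?f C')" if "B' \<in> p" "C' \<in> p" "?f B' \<noteq> ?f C'" for B' C'
      proof -
        have "B' \<noteq> C'" using that(3) by blast
        then have "B' \<inter> C' = {}" using disjointD[OF partition_onD2[OF part] that(1,2)] by blast
        then show ?thesis unfolding disjnt_def by (rule pull_disjoint)
      qed
      moreover have "disjnt {edge i (Suc i)} (?f B')" "disjnt (?f B') {edge i (Suc i)}" for B'
        using singleton_notin_pull by (simp_all add: disjnt_def)
      ultimately show ?thesis using that unfolding blow_up_def by blast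
    qed
  qed
  moreover have "card (blow_up n i p) = Suc k"
    using notin card finite_colouring[OF p] by (simp add: blow_up_def card_image[OF inj])
  moreover have "triangle (blow_up n i p) u v w"
    if uvw: "1 \<le> u" "u < v" "v < w" "w \<le> Suc n" for u v w
  proof -
    consider "u = i" "v = Suc i" | "v = i" "w = Suc i"
      | "\<not> (u = i \<and> v = Suc i)" "\<not> (v = i \<and> w = Suc i)" by blast
    then show ?thesis
    proof cases
      case 1
      then obtain B where B: "B \<in> p" "edge u w \<in> ?f B" using in_union[of u w] uvw by auto
      then have "edge v w \<in> ?f B"
        using 1 uvw by (auto simp: edge_in_pull collapse_def)
      then show ?thesis using B by (auto simp: triangle_def blow_up_def)
    next
      case 2
      then obtain B where B: "B \<in> p" "edge u v \<in> ?f B" using in_union[of u v] uvw by auto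
      then have "edge u w \<in> ?f B"
        using 2 uvw by (auto simp: edge_in_pull collapse_def)
      then show ?thesis using B by (auto simp: triangle_def blow_up_def)
    next
      case 3
      then have less: "collapse i u < collapse i v" "collapse i v < collapse i w"
        using uvw collapse_less_iff by blast+
      have "triangle p (collapse i u) (collapse i v) (collapse i w)"
        using less uvw i collapse_bounds by (intro colouring_triangle[OF p]) auto
      then show ?thesis
        using less less_trans[OF less] uvw unfolding triangle_def blow_up_def
        by (auto simp: edge_in_pull)
    qed
  qed
  ultimately show ?thesis by (simp add: colourings_def)
qed

text \<open>In a triangle on \<open>i\<close>, \<open>Suc i\<close> and a third vertex, the edge
  between the twins is alone in its block, so the other two edges must share one.\<close>

lemma twins:
  assumes p: "p \<in> colourings (Suc n) k" and s: "{edge i (Suc i)} \<in> p" and B: "B \<in> p"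
  shows "Suc i < w \<Longrightarrow> w \<le> Suc n \<Longrightarrow> edge i w \<in> B \<longleftrightarrow> edge (Suc i) w \<in> B"
    and "1 \<le> u \<Longrightarrow> u < i \<Longrightarrow> edge u i \<in> B \<longleftrightarrow> edge u (Suc i) \<in> B"
proof -
  have single: "e = edge i (Suc i)" if "C \<in> p" "edge i (Suc i) \<in> C" "e \<in> C" for C e
    using colouring_block_eq[OF p that(1) s that(2)] that(3) by simp
  {
    assume w: "Suc i < w" "w \<le> Suc n"
    have ne: "edge i w \<noteq> edge i (Suc i)" "edge (Suc i) w \<noteq> edge i (Suc i)"
      using w edge_inject[of i w i "Suc i"] edge_inject[of "Suc i" w i "Suc i"] by auto
    have "triangle p i (Suc i) w"
      using w i by (intro colouring_triangle[OF p]) auto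
    then obtain C where C: "C \<in> p" "edge i w \<in> C" "edge (Suc i) w \<in> C"
      using single ne unfolding triangle_def by metis
    show "edge i w \<in> B \<longleftrightarrow> edge (Suc i) w \<in> B"
      using C colouring_block_eq[OF p B C(1)] by blast
  next
    assume u: "1 \<le> u" "u < i"
    have ne: "edge u i \<noteq> edge i (Suc i)" "edge u (Suc i) \<noteq> edge i (Suc i)"
      using u edge_inject[of u i i "Suc i"] edge_inject[of u "Suc i" i "Suc i"] by auto
    have "triangle p u i (Suc i)"
      using u i by (intro colouring_triangle[OF p]) auto
    then obtain C where C: "C \<in> p" "edge u i \<in> C" "edge u (Suc i) \<in> C"
      using single ne unfolding triangle_def by metis
    show "edge u i \<in> B \<longleftrightarrow> edge u (Suc i) \<in> B"
      using C colouring_block_eq[OF p B C(1)] by blast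
  }
qed

text \<open>The round trip replaces an endpoint \<open>Suc i\<close> by \<open>i\<close>, which by
  \<open>twins\<close> does not change membership in a block.\<close>

lemma pull_collapse_expand:
  assumes p: "p \<in> colourings (Suc n) k" and s: "{edge i (Suc i)} \<in> p"
    and B: "B \<in> p" "B \<noteq> {edge i (Suc i)}"
  shows "pull (collapse i) (Suc n) (pull (expand i) n B) = B"
proof (rule edges_subset_eqI[OF pull_subset colouring_block_subset[OF p B(1)]])
  fix u v assume uv: "1 \<le> u" "u < v" "v \<le> Suc n"
  show "edge u v \<in> pull (collapse i) (Suc n) (pull (expand i) n B) \<longleftrightarrow> edge u v \<in> B"
  proof (cases "u = i \<and> v = Suc i")
    case True
    then have "edge u v \<notin> B" using colouring_block_eq[OF p B(1) s] B(2) by auto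
    then show ?thesis using True singleton_notin_pull by auto
  next
    case False
    then have less: "collapse i u < collapse i v" using uv collapse_less_iff by blast
    have "1 \<le> collapse i u" "collapse i v \<le> n" using uv i collapse_bounds by auto
    then have "edge u v \<in> pull (collapse i) (Suc n) (pull (expand i) n B) \<longleftrightarrow>
        edge (expand i (collapse i u)) (expand i (collapse i v)) \<in> B"
      using uv less by (simp add: edge_in_pull expand_less_iff)
    also have "\<dots> \<longleftrightarrow> edge u v \<in> B"
    proof -
      have *: "expand i (collapse i (Suc i)) = i" using i by (simp add: expand_def collapse_def)
      \<comment> \<open>Either one endpoint is \<open>Suc i\<close> and moves to \<open>i\<close>,
        or nothing moves. If \<open>v = Suc i\<close>, then \<open>u < i\<close> because the edge
        between the twins is excluded.\<close>
      consider "u = Suc i" | "v = Suc i" "u < i" | "u \<noteq> Suc i" "v \<noteq> Suc i"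
        using uv False by linarith
      then show ?thesis
      proof cases
        case 1
        then show ?thesis using twins(1)[OF p s B(1), of v] uv by (simp add: * expand_collapse)
      next
        case 2
        then show ?thesis using twins(2)[OF p s B(1), of u] uv by (simp add: * expand_collapse)
      qed (simp add: expand_collapse)
    qed
    finally show ?thesis .
  qed
qed

text \<open>Edges between vertices other than \<open>Suc i\<close> never lie in the removed
  singleton, and each other block survives the restriction because
  \<open>pull_collapse_expand\<close> recovers it.\<close>

lemma contract_colouring:
  assumes p: "p \<in> colourings (Suc n) (Suc k)" and s: "{edge i (Suc i)} \<in> p"
  shows "contract n i p \<in> colourings n k"
proof -
  let ?s = "{edge i (Suc i)}" and ?g = "pull (expand i) n"
  have part: "partition_on (edges (Suc n)) p" and card: "card p = Suc k"
    using p by (auto simp: colourings_def)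
  have inv: "pull (collapse i) (Suc n) (?g B) = B" if "B \<in> p - {?s}" for B
    using pull_collapse_expand[OF p s] that by blast
  have inj: "inj_on ?g (p - {?s})" by (rule inj_on_inverseI[where g = "pull (collapse i) (Suc n)"], rule inv)
  have not_single: "B \<noteq> ?s" if "edge (expand i u) (expand i v) \<in> B" "u < v" for B u v
  proof
    assume "B = ?s"
    then have "expand i u = i \<and> expand i v = Suc i"
      using that edge_inject[of "expand i u" "expand i v" i "Suc i"] by (simp add: expand_less_iff)
    then show False by (auto simp: expand_def split: if_splits)
  qed
  have "partition_on (edges n) (contract n i p)"
  proof (rule partition_onI)
    show "\<Union> (contract n i p) = edges n"
    proof (rule edges_subset_eqI[OF _ subset_refl])
      show "\<Union> (contract n i p) \<subseteq> edges n"
        using pull_subset by (auto simp: contract_def)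
      show "edge u v \<in> \<Union> (contract n i p) \<longleftrightarrow> edge u v \<in> edges n"
        if uv: "1 \<le> u" "u < v" "v \<le> n" for u v
      proof -
        have less: "expand i u < expand i v" using uv by (simp add: expand_less_iff)
        have "1 \<le> expand i u" "expand i v \<le> Suc n" using uv i expand_bounds by auto
        then have "edge (expand i u) (expand i v) \<in> \<Union> p"
          using part less by (simp add: partition_on_def edge_in_edges)
        then obtain B where B: "B \<in> p" "edge (expand i u) (expand i v) \<in> B" by blast
        then have "edge u v \<in> ?g B" using uv less by (simp add: edge_in_pull)
        moreover have "B \<noteq> ?s" using not_single[OF B(2)] uv(2) by blast
        ultimately have "edge u v \<in> \<Union> (contract n i p)" using B(1) by (auto simp: contract_def)
        then show ?thesis using uv by (simp add: edge_in_edges)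
      qed
    qed
    have "B \<noteq> {}" if B: "B \<in> contract n i p" for B
    proof -
      obtain C where C: "C \<in> p - {?s}" "B = ?g C" using B by (auto simp: contract_def)
      have "C \<noteq> {}" using C(1) part by (auto simp: partition_on_def)
      moreover have "pull (collapse i) (Suc n) {} = {}" by (simp add: pull_def)
      ultimately show ?thesis using inv[OF C(1)] C(2) by metis
    qed
    then show "{} \<notin> contract n i p" by blast
    show "disjnt B C" if BC: "B \<in> contract n i p" "C \<in> contract n i p" "B \<noteq> C" for B C
    proof -
      obtain B' C' where BC': "B' \<in> p" "C' \<in> p" "B = ?g B'" "C = ?g C'"
        using BC by (auto simp: contract_def)
      have "B' \<noteq> C'" using BC(3) BC' by blast
      then have "B' \<inter> C' = {}" using disjointD[OF partition_onD2[OF part] BC'(1,2)] by blast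
      then show ?thesis unfolding disjnt_def BC' by (rule pull_disjoint)
    qed
  qed
  moreover have "card (contract n i p) = k"
    using card s finite_colouring[OF p] by (simp add: contract_def card_image[OF inj])
  moreover have "triangle (contract n i p) u v w"
    if uvw: "1 \<le> u" "u < v" "v < w" "w \<le> n" for u v w
  proof -
    have less: "expand i u < expand i v" "expand i v < expand i w"
      using uvw by (simp_all add: expand_less_iff)
    have "triangle p (expand i u) (expand i v) (expand i w)"
      using less uvw i expand_bounds by (intro colouring_triangle[OF p]) auto
    then obtain B where B: "B \<in> p" "edge (expand i u) (expand i w) \<in> B \<and>
        (edge (expand i u) (expand i v) \<in> B \<or> edge (expand i v) (expand i w) \<in> B) \<or>
        gallai \<and> edge (expand i u) (expand i v) \<in> B \<and> edge (expand i v) (expand i w) \<in> B"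
      unfolding triangle_def by blast
    have "B \<noteq> ?s" using B(2) not_single uvw less_trans by blast
    then have "?g B \<in> contract n i p" using B(1) by (simp add: contract_def)
    moreover have "edge u w \<in> ?g B \<and> (edge u v \<in> ?g B \<or> edge v w \<in> ?g B) \<or>
        gallai \<and> edge u v \<in> ?g B \<and> edge v w \<in> ?g B"
      using B(2) uvw by (simp add: edge_in_pull expand_less_iff)
    ultimately show ?thesis unfolding triangle_def by blast
  qed
  ultimately show ?thesis by (simp add: colourings_def)
qed

text \<open>Prescribing one singleton block costs one vertex and one block, whatever its position
  \<open>i\<close>.\<close>

lemma blow_up_bij:
  "bij_betw (blow_up n i) (colourings n k) {p \<in> colourings (Suc n) (Suc k). {edge i (Suc i)} \<in> p}"
proof (rule bij_betw_byWitness[where f' = "contract n i"])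
  show "\<forall>p\<in>colourings n k. contract n i (blow_up n i p) = p"
  proof
    fix p assume p: "p \<in> colourings n k"
    have "{edge i (Suc i)} \<notin> pull (collapse i) (Suc n) ` p" using singleton_notin_pull by blast
    then have "contract n i (blow_up n i p) = (\<lambda>B. pull (expand i) n (pull (collapse i) (Suc n) B)) ` p"
      by (simp add: contract_def blow_up_def image_image)
    also have "\<dots> = id ` p"
      by (rule image_cong[OF refl]) (simp add: pull_expand_collapse colouring_block_subset[OF p])
    finally show "contract n i (blow_up n i p) = p" by simp
  qed
  show "\<forall>p\<in>{p \<in> colourings (Suc n) (Suc k). {edge i (Suc i)} \<in> p}. blow_up n i (contract n i p) = p"
  proof
    fix p assume "p \<in> {p \<in> colourings (Suc n) (Suc k). {edge i (Suc i)} \<in> p}"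
    then have p: "p \<in> colourings (Suc n) (Suc k)" "{edge i (Suc i)} \<in> p" by auto
    have "blow_up n i (contract n i p) = insert {edge i (Suc i)}
        ((\<lambda>B. pull (collapse i) (Suc n) (pull (expand i) n B)) ` (p - {{edge i (Suc i)}}))"
      by (simp add: contract_def blow_up_def image_image)
    also have "(\<lambda>B. pull (collapse i) (Suc n) (pull (expand i) n B)) ` (p - {{edge i (Suc i)}}) =
        id ` (p - {{edge i (Suc i)}})"
      by (rule image_cong[OF refl]) (simp add: pull_collapse_expand[OF p])
    finally show "blow_up n i (contract n i p) = p" using p(2) by auto
  qed
  show "blow_up n i ` colourings n k \<subseteq> {p \<in> colourings (Suc n) (Suc k). {edge i (Suc i)} \<in> p}"
    using blow_up_colouring by (auto simp: blow_up_def)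
  show "contract n i ` {p \<in> colourings (Suc n) (Suc k). {edge i (Suc i)} \<in> p} \<subseteq> colourings n k"
    using contract_colouring by blast
qed

text \<open>Only \<open>i\<close> has two preimages under \<open>collapse i\<close>, so an edge
  strictly to the left of \<open>i\<close> is its own only preimage. The converse holds because
  blocks can be recovered from their preimages.\<close>

lemma singleton_in_blow_up:
  assumes p: "p \<in> colourings n k" and j: "1 \<le> j" "Suc j < i"
  shows "{edge j (Suc j)} \<in> blow_up n i p \<longleftrightarrow> {edge j (Suc j)} \<in> p"
proof -
  have inj: "edge j (Suc j) = edge u v \<longleftrightarrow> u = j \<and> v = Suc j" if "u < v" for u v
    using that edge_inject[of j "Suc j" u v] by auto
  have f: "pull (collapse i) (Suc n) {edge j (Suc j)} = {edge j (Suc j)}"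
  proof (rule edges_subset_eqI[OF pull_subset])
    show "{edge j (Suc j)} \<subseteq> edges (Suc n)" using i j by (simp add: edge_in_edges)
    fix u v assume "1 \<le> u" "u < v" "v \<le> Suc n"
    then show "edge u v \<in> pull (collapse i) (Suc n) {edge j (Suc j)} \<longleftrightarrow> edge u v \<in> {edge j (Suc j)}"
      using j inj[of u v] inj[of "collapse i u" "collapse i v"]
      by (auto simp: edge_in_pull collapse_def split: if_splits)
  qed
  have sub: "{edge j (Suc j)} \<subseteq> edges n" using i j by (simp add: edge_in_edges)
  have "edge j (Suc j) \<noteq> edge i (Suc i)" using j inj[of i "Suc i"] by auto
  then have "{edge j (Suc j)} \<in> blow_up n i p \<longleftrightarrow>
      {edge j (Suc j)} \<in> pull (collapse i) (Suc n) ` p" by (simp add: blow_up_def)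
  also have "\<dots> \<longleftrightarrow> {edge j (Suc j)} \<in> p"
  proof
    assume "{edge j (Suc j)} \<in> pull (collapse i) (Suc n) ` p"
    then obtain B where B: "B \<in> p" "pull (collapse i) (Suc n) B = pull (collapse i) (Suc n) {edge j (Suc j)}"
      using f by auto
    then have "B = {edge j (Suc j)}"
      using pull_expand_collapse[OF colouring_block_subset[OF p B(1)]] pull_expand_collapse[OF sub]
      by metis
    then show "{edge j (Suc j)} \<in> p" using B(1) by simp
  next
    assume "{edge j (Suc j)} \<in> p"
    then show "{edge j (Suc j)} \<in> pull (collapse i) (Suc n) ` p" using f by (metis imageI)
  qed
  finally show ?thesis .
qed

end

text \<open>The largest element of \<open>J\<close> is contracted first, since the others lie far
  enough to the left to keep their labels. The explicit 0 matters: \<open>k - card J\<close> is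
  truncated, and \<open>colourings m 0\<close> contains the empty partition if
  \<open>m \<le> 1\<close>.\<close>

lemma card_singletons:
  assumes "finite J" "J \<subseteq> {1..<n}" "\<And>i. i \<in> J \<Longrightarrow> Suc i \<notin> J"
  shows "card {p \<in> colourings n k. \<forall>j\<in>J. {edge j (Suc j)} \<in> p} =
    (if card J \<le> k then card (colourings (n - card J) (k - card J)) else 0)"
  using assms
proof (induction J arbitrary: n k rule: finite_linorder_max_induct)
  case (insert i J)
  obtain n' where n: "n = Suc n'" using insert.prems(1) by (cases n) auto
  have i: "1 \<le> i" "i \<le> n'" using insert.prems(1) n by auto
  have J: "1 \<le> j \<and> Suc j < i" if "j \<in> J" for j
    using that insert.hyps(2) insert.prems(1) insert.prems(2)[of j] by (auto simp: Suc_lessI)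
  have "i \<notin> J" using insert.hyps(2) by blast
  then have card: "card (insert i J) = Suc (card J)" using insert.hyps(1) by simp
  show ?case
  proof (cases k)
    case 0
    \<comment> \<open>Finiteness is what turns \<open>card p = 0\<close> into emptiness.\<close>
    have "p = {}" if "p \<in> colourings n 0" for p
      using that finite_colouring[OF that] by (simp add: colourings_def)
    then have "{p \<in> colourings n 0. \<forall>j\<in>insert i J. {edge j (Suc j)} \<in> p} = {}" by blast
    then have "card {p \<in> colourings n 0. \<forall>j\<in>insert i J. {edge j (Suc j)} \<in> p} = 0"
      by (simp only: card.empty)
    then show ?thesis using 0 card by simp
  next
    case (Suc k')
    have "bij_betw (blow_up n' i) {p \<in> colourings n' k'. \<forall>j\<in>J. {edge j (Suc j)} \<in> p}
        {p \<in> {p \<in> colourings n k. {edge i (Suc i)} \<in> p}. \<forall>j\<in>J. {edge j (Suc j)} \<in> p}"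
      using blow_up_bij[OF i, of k'] singleton_in_blow_up[OF i] J
      unfolding n Suc by (intro bij_betw_Collect) auto
    then have "card {p \<in> colourings n k. \<forall>j\<in>insert i J. {edge j (Suc j)} \<in> p} =
        card {p \<in> colourings n' k'. \<forall>j\<in>J. {edge j (Suc j)} \<in> p}"
      by (simp add: bij_betw_same_card conj_assoc)
    also have "\<dots> = (if card J \<le> k' then card (colourings (n' - card J) (k' - card J)) else 0)"
    proof (rule insert.IH)
      show "J \<subseteq> {1..<n'}" using J i by force
      show "Suc j \<notin> J" if "j \<in> J" for j using that insert.prems(2) by blast
    qed
    finally show ?thesis by (simp add: card n Suc)
  qed
qed simp

text \<open>Two adjacent singletons would put the three edges of a triangle into three different
  blocks.\<close>

lemma no_adjacent_singletons:
  assumes p: "p \<in> colourings n k" and i: "1 \<le> i" "Suc (Suc i) \<le> n"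
    and s: "{edge i (Suc i)} \<in> p"
  shows "{edge (Suc i) (Suc (Suc i))} \<notin> p"
proof
  assume s': "{edge (Suc i) (Suc (Suc i))} \<in> p"
  have "edge i (Suc (Suc i)) \<noteq> edge i (Suc i)"
    "edge i (Suc (Suc i)) \<noteq> edge (Suc i) (Suc (Suc i))"
    "edge i (Suc i) \<noteq> edge (Suc i) (Suc (Suc i))"
    using edge_inject[of i "Suc (Suc i)" i "Suc i"]
      edge_inject[of i "Suc (Suc i)" "Suc i" "Suc (Suc i)"]
      edge_inject[of i "Suc i" "Suc i" "Suc (Suc i)"] by auto
  moreover have "triangle p i (Suc i) (Suc (Suc i))"
    using i by (intro colouring_triangle[OF p]) auto
  then obtain B where "B \<in> p" "edge i (Suc (Suc i)) \<in> B \<and>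
      (edge i (Suc i) \<in> B \<or> edge (Suc i) (Suc (Suc i)) \<in> B) \<or>
      edge i (Suc i) \<in> B \<and> edge (Suc i) (Suc (Suc i)) \<in> B"
    unfolding triangle_def by blast
  ultimately show False
    using colouring_block_eq[OF p _ s] colouring_block_eq[OF p _ s'] by (metis singletonD singletonI)
qed

lemma sparse_statistic_colourings:
  assumes "1 \<le> n"
  shows "sparse_statistic (colourings n k) (descents n edge) n
    (\<lambda>r. if r \<le> k then card (colourings (n - r) (k - r)) else 0)"
proof
  show "finite (colourings n k)" by (rule finite_colourings)
  show "1 \<le> n" by (rule assms)
  show "descents n edge p \<subseteq> {1..<n}" for p
    using assms by (auto simp: descents_def)
  show "Suc i \<notin> descents n edge p" if "p \<in> colourings n k" "i \<in> descents n edge p" for p i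
    using no_adjacent_singletons[OF that(1), of i] that(2) by (auto simp: descents_def)
  fix J :: "nat set"
  assume J: "J \<subseteq> {1..<n}" "\<And>i. i \<in> J \<Longrightarrow> Suc i \<notin> J"
  have "finite J" using J(1) finite_subset by blast
  have "{p \<in> colourings n k. J \<subseteq> descents n edge p} =
      {p \<in> colourings n k. \<forall>j\<in>J. {edge j (Suc j)} \<in> p}"
    using J(1) by (force simp: descents_def)
  then show "card {p \<in> colourings n k. J \<subseteq> descents n edge p} =
      (if card J \<le> k then card (colourings (n - card J) (k - card J)) else 0)"
    using card_singletons[OF \<open>finite J\<close> J] by simp
qed

end

section \<open>Cycles and triangles\<close>

lemma steps_eq_zip: "steps vs = set (zip vs (rotate1 vs))"
  by (auto simp: steps_def set_zip nth_rotate1)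

lemma steps_Cons: "steps (a # l) = set (zip (a # l) (l @ [a]))"
  by (simp add: steps_eq_zip)

lemma cycle_in_complete:
  assumes "is_cycle (complete_edges n) vs"
  shows "3 \<le> length vs" "distinct vs" "set vs \<subseteq> {1..n}"
proof -
  show "3 \<le> length vs" "distinct vs" using assms by (auto simp: is_cycle_def)
  show "set vs \<subseteq> {1..n}"
  proof
    fix v assume "v \<in> set vs"
    then obtain i where "i < length vs" "v = vs ! i" by (auto simp: in_set_conv_nth)
    then have "(v, vs ! (Suc i mod length vs)) \<in> steps vs" by (auto simp: steps_def)
    then have "{v, vs ! (Suc i mod length vs)} \<in> complete_edges n"
      using assms by (auto simp: is_cycle_def)
    then show "v \<in> {1..n}" by (auto simp: complete_edges_def doubleton_eq_iff)
  qed
qed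

lemma steps_triangle: "steps [u, v, w] = {(u, v), (v, w), (w, u)}"
  by (auto simp: steps_Cons)

lemma is_cycle_triangle:
  assumes "1 \<le> u" "u < v" "v < w" "w \<le> n"
  shows "is_cycle (complete_edges n) [u, v, w]"
proof -
  have "{a, b} \<in> complete_edges n" if "a \<in> {1..n}" "b \<in> {1..n}" "a \<noteq> b" for a b
    using that unfolding complete_edges_def by blast
  then show ?thesis using assms by (simp add: is_cycle_def steps_triangle)
qed

lemma underlying_tournament_edges: "underlying_edges (tournament_edges n) = complete_edges n"
proof -
  have "\<exists>u v. {i, j} = {u, v} \<and> (u, v) \<in> tournament_edges n"
    if "i \<in> {1..n}" "j \<in> {1..n}" "i \<noteq> j" for i j
  proof (cases "i < j")
    case True
    then show ?thesis using that unfolding tournament_edges_def by blast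
  next
    case False
    then have "(j, i) \<in> tournament_edges n" using that by (simp add: tournament_edges_def)
    then show ?thesis by (metis insert_commute)
  qed
  then have "complete_edges n \<subseteq> underlying_edges (tournament_edges n)"
    unfolding underlying_edges_def complete_edges_def by blast
  moreover have "underlying_edges (tournament_edges n) \<subseteq> complete_edges n"
    unfolding underlying_edges_def complete_edges_def tournament_edges_def by blast
  ultimately show ?thesis by blast
qed

text \<open>A longer cycle \<open>a, b, c, \<dots>\<close> is cut along its chord from \<open>a\<close> to \<open>c\<close>.\<close>

lemma cycle_induct:
  assumes len: "3 \<le> length vs" and "distinct vs" "set vs \<subseteq> V"
    and triangle: "\<And>a b c. \<lbrakk>a \<in> V; b \<in> V; c \<in> V; distinct [a, b, c]\<rbrakk> \<Longrightarrow>
      R {(a, b), (b, c), (c, a)}"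
    and chord: "\<And>a b c W. \<lbrakk>distinct [a, b, c]; \<And>u v. (u, v) \<in> W \<Longrightarrow> u \<noteq> b \<and> v \<noteq> b;
      R {(a, b), (b, c), (c, a)}; R (insert (a, c) W)\<rbrakk> \<Longrightarrow> R (insert (a, b) (insert (b, c) W))"
  shows "R (steps vs)"
  using assms(1-3)
proof (induction "length vs" arbitrary: vs rule: less_induct)
  case less
  obtain a b c r where vs: "vs = a # b # c # r"
    using less.prems(1) by (auto simp: numeral_3_eq_3 Suc_le_length_iff)
  have tri: "R {(a, b), (b, c), (c, a)}"
    using less.prems vs by (intro triangle) auto
  show ?case
  proof (cases r)
    case Nil
    then show ?thesis using tri vs by (simp add: steps_triangle)
  next
    case (Cons d r')
    define W where "W = set (zip (c # r) (r @ [a]))"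
    \<comment> \<open>Both cycles share the path \<open>W\<close> from \<open>c\<close> back to
      \<open>a\<close>; one then goes through \<open>b\<close>, the other along the chord.\<close>
    have s: "steps vs = insert (a, b) (insert (b, c) W)" "steps (a # c # r) = insert (a, c) W"
      by (simp_all add: vs steps_Cons W_def)
    have chord': "R (insert (a, c) W)"
      unfolding s(2)[symmetric] by (rule less.hyps) (use less.prems Cons in \<open>auto simp: vs\<close>)
    have W: "u \<noteq> b \<and> v \<noteq> b" if "(u, v) \<in> W" for u v
      using set_zip_leftD[OF that[unfolded W_def]] set_zip_rightD[OF that[unfolded W_def]]
        less.prems(2) by (auto simp: vs)
    have "distinct [a, b, c]" using less.prems(2) by (simp add: vs)
    from this W tri chord' show ?thesis unfolding s(1) by (rule chord)
  qed
qed

lemma ordered_triple_cases: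
  fixes a b c :: "'a :: linorder"
  assumes "distinct [a, b, c]"
  obtains "a < b" "b < c" | "a < c" "c < b" | "b < a" "a < c" | "b < c" "c < a"
    | "c < a" "a < b" | "c < b" "b < a"
  using assms by (metis distinct_length_2_or_more linorder_neqE)

section \<open>From cycle conditions to triangle conditions for both families\<close>

interpretation gallai: edge_colouring "\<lambda>i j. {i, j}" True
  by unfold_locales (auto simp: doubleton_eq_iff)

interpretation transitive: edge_colouring Pair False
  by unfold_locales auto

lemma gallai_edges: "gallai.edges n = complete_edges n"
  unfolding underlying_tournament_edges[symmetric] underlying_edges_def gallai.edges_def
    tournament_edges_def by force

lemma transitive_edges: "transitive.edges n = tournament_edges n"
  unfolding transitive.edges_def tournament_edges_def by force

lemma same_block_trans:
  assumes "partition_on A p" "\<exists>B\<in>p. x \<in> B \<and> y \<in> B" "\<exists>B\<in>p. y \<in> B \<and> z \<in> B"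
  shows "\<exists>B\<in>p. x \<in> B \<and> z \<in> B"
proof -
  obtain B C where BC: "B \<in> p" "x \<in> B" "y \<in> B" "C \<in> p" "y \<in> C" "z \<in> C"
    using assms(2,3) by blast
  then have "B = C" using disjointD[OF partition_onD2[OF assms(1)], of B C] by blast
  with BC show ?thesis by blast
qed

text \<open>Cut a cycle along the chord \<open>{a, c}\<close>. If the shorter cycle needs the chord
  for its repeated block, the triangle \<open>a, b, c\<close> either repeats a block on its two
  outer edges or has an outer edge in the block of the chord, which then replaces the chord.\<close>

lemma gallai_condition_iff:
  assumes p: "partition_on (complete_edges n) p"
  shows "(\<forall>vs. is_cycle (complete_edges n) vs \<longrightarrow>
       (\<exists>B\<in>p. \<exists>(u, v)\<in>steps vs. \<exists>(u', v')\<in>steps vs.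
          {u, v} \<noteq> {u', v'} \<and> {u, v} \<in> B \<and> {u', v'} \<in> B)) \<longleftrightarrow>
    (\<forall>u v w. 1 \<le> u \<longrightarrow> u < v \<longrightarrow> v < w \<longrightarrow> w \<le> n \<longrightarrow> gallai.triangle p u v w)"
    (is "?L \<longleftrightarrow> ?R")
proof -
  define same where "same e e' \<longleftrightarrow> (\<exists>B\<in>p. e \<in> B \<and> e' \<in> B)" for e e'
  define C where "C S \<longleftrightarrow> (\<exists>(u, v)\<in>S. \<exists>(u', v')\<in>S. {u, v} \<noteq> {u', v'} \<and> same {u, v} {u', v'})"
    for S :: "(nat \<times> nat) set"
  have sym: "same e' e" if "same e e'" for e e' using that unfolding same_def by blast
  have trans: "same e e''" if "same e e'" "same e' e''" for e e' e''
    using that unfolding same_def by (rule same_block_trans[OF p])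
  have L: "?L \<longleftrightarrow> (\<forall>vs. is_cycle (complete_edges n) vs \<longrightarrow> C (steps vs))"
    unfolding C_def same_def by (intro all_cong1 imp_cong refl) blast
  have C_triangle: "C {(a, b), (b, c), (c, a)} \<longleftrightarrow>
      same {a, b} {b, c} \<or> same {b, c} {a, c} \<or> same {a, b} {a, c}" if "distinct [a, b, c]" for a b c
  proof -
    have "{a, b} \<noteq> {b, c}" "{b, c} \<noteq> {a, c}" "{a, b} \<noteq> {a, c}" "{c, a} = {a, c}"
      using that by (auto simp: doubleton_eq_iff)
    then show ?thesis unfolding C_def using sym by (simp, metis)
  qed
  have triangle: "gallai.triangle p u v w \<longleftrightarrow>
      same {u, v} {v, w} \<or> same {v, w} {u, w} \<or> same {u, v} {u, w}" for u v w
  proof -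
    have "(\<exists>B\<in>p. e'' \<in> B \<and> (e \<in> B \<or> e' \<in> B) \<or> True \<and> e \<in> B \<and> e' \<in> B) \<longleftrightarrow>
        same e e' \<or> same e' e'' \<or> same e e''" for e e' e''
      unfolding same_def by blast
    then show ?thesis unfolding gallai.triangle_def .
  qed
  show ?thesis
    unfolding L triangle
  proof (intro iffI allI impI)
    fix u v w
    assume "\<forall>vs. is_cycle (complete_edges n) vs \<longrightarrow> C (steps vs)" "1 \<le> u" "u < v" "v < w" "w \<le> n"
    then show "same {u, v} {v, w} \<or> same {v, w} {u, w} \<or> same {u, v} {u, w}"
      using is_cycle_triangle[of u v w n] C_triangle[of u v w] steps_triangle by auto
  next
    fix vs
    assume R: "\<forall>u v w. 1 \<le> u \<longrightarrow> u < v \<longrightarrow> v < w \<longrightarrow> w \<le> n \<longrightarrow>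
        same {u, v} {v, w} \<or> same {v, w} {u, w} \<or> same {u, v} {u, w}"
      and "is_cycle (complete_edges n) vs"
    from cycle_in_complete[OF this(2)] show "C (steps vs)"
    proof (rule cycle_induct)
      fix a b c assume "a \<in> {1..n}" "b \<in> {1..n}" "c \<in> {1..n}" and d: "distinct [a, b, c]"
      then show "C {(a, b), (b, c), (c, a)}"
        unfolding C_triangle[OF d]
        by (cases rule: ordered_triple_cases[OF d])
          (use R[rule_format, of a b c] R[rule_format, of a c b] R[rule_format, of b a c]
            R[rule_format, of b c a] R[rule_format, of c a b] R[rule_format, of c b a] sym
            in \<open>auto simp: insert_commute\<close>)
    next
      fix a b c and W :: "(nat \<times> nat) set"
      assume d: "distinct [a, b, c]" and W: "\<And>u v. (u, v) \<in> W \<Longrightarrow> u \<noteq> b \<and> v \<noteq> b"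
        and tri: "C {(a, b), (b, c), (c, a)}" and "C (insert (a, c) W)"
      then obtain u v u' v' where uv: "(u, v) \<in> insert (a, c) W" "(u', v') \<in> insert (a, c) W"
          "{u, v} \<noteq> {u', v'}" "same {u, v} {u', v'}"
        unfolding C_def by blast
      let ?S = "insert (a, b) (insert (b, c) W)"
      have intro: "C ?S" if "(x, y) \<in> ?S" "(x', y') \<in> ?S" "{x, y} \<noteq> {x', y'}" "same {x, y} {x', y'}"
        for x y x' y' using that unfolding C_def by blast
      have chord: "C ?S" if "(x, y) \<in> W" "same {a, c} {x, y}" for x y
      proof -
        \<comment> \<open>Steps in \<open>W\<close> avoid \<open>b\<close>, so the two edges found
          are distinct.\<close>
        have "{a, b} \<noteq> {x, y}" "{b, c} \<noteq> {x, y}" using W[OF that(1)] by auto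
        moreover have "{a, b} \<noteq> {b, c}" using d by (auto simp: doubleton_eq_iff)
        moreover have "same {a, b} {b, c} \<or> same {b, c} {x, y} \<or> same {a, b} {x, y}"
          using tri[unfolded C_triangle[OF d]] trans that(2) by blast
        ultimately show ?thesis using intro[of a b b c] intro[of b c x y] intro[of a b x y] that(1) by blast
      qed
      show "C ?S"
        using uv chord sym intro[of u v u' v'] by blast
    qed
  qed
qed

text \<open>The same cut with orientations. The triangle \<open>a, b, c\<close> passes the chord
  opposite to the shorter cycle, so an outer edge paired with the chord runs in the direction the
  chord had there and can replace it.\<close>

lemma transitive_condition_iff:
  assumes p: "partition_on (tournament_edges n) p"
  shows "(\<forall>vs. is_cycle (complete_edges n) vs \<longrightarrow>
       (\<exists>B\<in>p. \<exists>(u, v)\<in>steps vs. \<exists>(u', v')\<in>steps vs. (u, v) \<in> B \<and> (v', u') \<in> B)) \<longleftrightarrow>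
    (\<forall>u v w. 1 \<le> u \<longrightarrow> u < v \<longrightarrow> v < w \<longrightarrow> w \<le> n \<longrightarrow> transitive.triangle p u v w)"
    (is "?L \<longleftrightarrow> ?R")
proof -
  define same where "same e e' \<longleftrightarrow> (\<exists>B\<in>p. e \<in> B \<and> e' \<in> B)" for e e'
  define C where "C S \<longleftrightarrow> (\<exists>(u, v)\<in>S. \<exists>(u', v')\<in>S. same (u, v) (v', u'))"
    for S :: "(nat \<times> nat) set"
  have sym: "same e' e" if "same e e'" for e e' using that unfolding same_def by blast
  have trans: "same e e''" if "same e e'" "same e' e''" for e e' e''
    using that unfolding same_def by (rule same_block_trans[OF p])
  have less: "u < v" if "same (u, v) e" for u v e
    using that partition_onD1[OF p] unfolding same_def tournament_edges_def by blast
  have L: "?L \<longleftrightarrow> (\<forall>vs. is_cycle (complete_edges n) vs \<longrightarrow> C (steps vs))"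
    unfolding C_def same_def by (intro all_cong1 imp_cong refl) blast
  have C_mono: "C S'" if "C S" "S \<subseteq> S'" for S S' using that unfolding C_def by blast
  have triangle: "transitive.triangle p u v w \<longleftrightarrow> same (u, w) (u, v) \<or> same (u, w) (v, w)" for u v w
    unfolding transitive.triangle_def same_def by blast
  show ?thesis
    unfolding L triangle
  proof (intro iffI allI impI)
    fix u v w
    assume "\<forall>vs. is_cycle (complete_edges n) vs \<longrightarrow> C (steps vs)"
      and uvw: "1 \<le> u" "u < v" "v < w" "w \<le> n"
    then have "C {(u, v), (v, w), (w, u)}"
      using is_cycle_triangle[of u v w n] steps_triangle by auto
    \<comment> \<open>Blocks contain only increasing pairs, so the short edges are passed forwards
      and the long one backwards; an opposite pair must contain the long edge.\<close>
    moreover have "\<not> same (v, u) e" "\<not> same (w, v) e" "\<not> same (w, u) e" for e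
      using less uvw by (meson less_trans not_less_iff_gr_or_eq)+
    ultimately show "same (u, w) (u, v) \<or> same (u, w) (v, w)"
      unfolding C_def using sym by simp blast
  next
    fix vs
    assume R: "\<forall>u v w. 1 \<le> u \<longrightarrow> u < v \<longrightarrow> v < w \<longrightarrow> w \<le> n \<longrightarrow> same (u, w) (u, v) \<or> same (u, w) (v, w)"
      and "is_cycle (complete_edges n) vs"
    from cycle_in_complete[OF this(2)] show "C (steps vs)"
    proof (rule cycle_induct)
      fix a b c assume V: "a \<in> {1..n}" "b \<in> {1..n}" "c \<in> {1..n}" and d: "distinct [a, b, c]"
      have fwd: "C {(u, v), (v, w), (w, u)}" "C {(v, u), (w, v), (u, w)}"
        if "u \<in> {1..n}" "w \<in> {1..n}" "u < v" "v < w" for u v w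
        using R[rule_format, of u v w] that sym unfolding C_def by auto
      show "C {(a, b), (b, c), (c, a)}"
        by (cases rule: ordered_triple_cases[OF d])
          (use fwd[of a b c] fwd[of a c b] fwd[of b a c] fwd[of b c a] fwd[of c a b] fwd[of c b a] V
            in \<open>auto simp: insert_commute\<close>)
    next
      fix a b c and W :: "(nat \<times> nat) set"
      assume "C {(a, b), (b, c), (c, a)}" and "C (insert (a, c) W)"
      then obtain u v u' v' x y x' y' where uv: "(u, v) \<in> insert (a, c) W" "(u', v') \<in> insert (a, c) W"
          "same (u, v) (v', u')"
        and xy: "(x, y) \<in> {(a, b), (b, c), (c, a)}" "(x', y') \<in> {(a, b), (b, c), (c, a)}"
          "same (x, y) (y', x')"
        unfolding C_def by blast
      let ?S = "insert (a, b) (insert (b, c) W)"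
      have intro: "C ?S" if "(q, r) \<in> ?S" "(q', r') \<in> ?S" "same (q, r) (r', q')"
        for q r q' r' using that unfolding C_def by blast
      have asym: "\<not> (same (a, c) e \<and> same (c, a) e')" for e e'
        using less by (meson less_asym)
      consider "(u, v) \<in> W" "(u', v') \<in> W" | "(u, v) = (a, c)" "(u', v') = (a, c)"
        | "(u, v) = (a, c)" "(u', v') \<in> W" | "(u, v) \<in> W" "(u', v') = (a, c)"
        using uv by blast
      then show "C ?S"
      proof cases
        case 1
        then show ?thesis using intro uv(3) by blast
      next
        case 2
        then show ?thesis using uv(3) asym sym by blast
      next
        case 3
        \<comment> \<open>The shorter cycle passes the chord forwards, so the forward step of the
          triangle is an outer one. If the backward step is the chord, the forward step shares the
          block of \<open>(v', u')\<close> by transitivity.\<close>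
        then have ac: "same (a, c) (v', u')" using uv(3) by simp
        then have "(x, y) \<noteq> (c, a)" using xy(3) asym by blast
        then have "(x, y) \<in> ?S" using xy(1) by blast
        moreover have "(x', y') \<in> ?S \<or> same (x, y) (v', u')"
          using xy(2,3) trans[OF _ ac] by blast
        ultimately show ?thesis using intro[of x y x' y'] intro[of x y u' v'] xy(3) 3(2) by blast
      next
        case 4
        \<comment> \<open>The mirror image: the chord is passed backwards, so the backward step of
          the triangle is an outer one.\<close>
        then have ca: "same (u, v) (c, a)" using uv(3) by simp
        then have "(x', y') \<noteq> (c, a)" using xy(3) asym sym by blast
        then have "(x', y') \<in> ?S" using xy(2) by blast
        moreover have "(x, y) \<in> ?S \<or> same (u, v) (y', x')"
          using xy(1,3) trans[OF ca] by blast
        ultimately show ?thesis using intro[of x y x' y'] intro[of u v x' y'] xy(3) 4(1) by blast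
      qed
    qed
  qed
qed

lemma gallai_partitions_eq: "gallai_partitions n k = gallai.colourings n k"
  unfolding gallai_partitions_def gallai.colourings_def gallai_edges
  by (intro Collect_cong conj_cong refl gallai_condition_iff)

lemma transitive_partitions_eq: "transitive_partitions n k = transitive.colourings n k"
  unfolding transitive_partitions_def transitive.colourings_def transitive_edges
    underlying_tournament_edges
  by (intro Collect_cong conj_cong refl transitive_condition_iff)

theorem theorem1p23:
  fixes n k :: nat
  assumes "n > k" and "k \<ge> 1"
  shows "symmetric_function (Q_gallai n k) \<and> schur_positive (Q_gallai n k) \<and>
    symmetric_function (Q_transitive n k) \<and> schur_positive (Q_transitive n k)"
proof -
  have "1 \<le> n" using assms by simp
  then interpret g: sparse_statistic "gallai.colourings n k" "descents n (\<lambda>i j. {i, j})" n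
      "\<lambda>r. if r \<le> k then card (gallai.colourings (n - r) (k - r)) else 0"
    by (rule gallai.sparse_statistic_colourings)
  interpret t: sparse_statistic "transitive.colourings n k" "descents n Pair" n
      "\<lambda>r. if r \<le> k then card (transitive.colourings (n - r) (k - r)) else 0"
    by (rule transitive.sparse_statistic_colourings) fact
  have "Q_gallai n k = g.Q" "Q_transitive n k = t.Q"
    by (simp_all add: Q_gallai_def Q_transitive_def g.Q_def t.Q_def
        gallai_partitions_eq transitive_partitions_eq)
  then show ?thesis
    using g.symmetric_Q g.schur_positive_Q t.symmetric_Q t.schur_positive_Q by simp
qed

end
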